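(* Let $\Omega\subset\mathbb{C}^n$ be a convexifiable strongly Goldilocks domain. Then there exists a constant $c>0$ such that for all $x,y\in\Omega$, $$k_\Omega(x,y)\ge\frac12\log\left(\frac{\delta_\Omega(y)}{\delta_\Omega(x)}\right)-c.$$
   Context: $\delta_\Omega(x)=\inf\{\|x-y\|:y\in\partial\Omega\}$; $\kappa_\Omega$ is the Kobayashi–Royden pseudometric and $k_\Omega$ the Kobayashi distance. $\Omega$ is convexifiable if for every $p\in\partial\Omega$ there is a neighbourhood $U_p$ and a biholomorphism $\Phi$ from $U_p$ onto an open set with $\Phi(\Omega\cap U_p)$ convex. $\Omega$ is strongly Goldilocks (SG) if it is bounded, its boundary is Dini-smooth (inner unit normal Dini-continuous near every boundary point), and there exist $c_0>0$ and $\omega_\Omega:(0,\infty)\to(0,\infty)$ with $\kappa_\Omega(x;v)\ge \frac{c_0\|v\|}{\omega_\Omega(\delta_\Omega(x))}$ for all $x\in\Omega,v\in\mathbb{C}^n$, where (a) $\omega_\Omega(x)/x$ is decreasing, (b) $\omega_\Omega(x)\log(\omega_\Omega(x)/x)$ is increasing, (c) $\int_0^\epsilon\frac{\omega_\Omega(x)}{x}\log\left(\frac{\omega_\Omega(x)}{x}\right)dx<\infty$ for every $\epsilon>0$. *)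

theory Defs
  imports "HOL-Complex_Analysis.Complex_Analysis"
begin

definition bdist :: "(complex ^ 'n) set \<Rightarrow> complex ^ 'n \<Rightarrow> real" where
  "bdist \<Omega> x = infdist x (frontier \<Omega>)"

definition complex_linear :: "(complex ^ 'n \<Rightarrow> complex ^ 'm) \<Rightarrow> bool" where
  "complex_linear L \<longleftrightarrow> (\<forall>u v. L (u + v) = L u + L v) \<and> (\<forall>c v. L (c *s v) = c *s L v)"

definition holo_on :: "(complex ^ 'n) set \<Rightarrow> (complex ^ 'n \<Rightarrow> complex ^ 'm) \<Rightarrow> bool" where
  "holo_on U f \<longleftrightarrow> (\<forall>x\<in>U. \<exists>L. (f has_derivative L) (at x) \<and> complex_linear L)"

definition biholo_onto_open :: "(complex ^ 'n) set \<Rightarrow> (complex ^ 'n \<Rightarrow> complex ^ 'n) \<Rightarrow> bool" where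
  "biholo_onto_open U \<Phi> \<longleftrightarrow> open U \<and> open (\<Phi> ` U) \<and> inj_on \<Phi> U \<and> holo_on U \<Phi> \<and>
     (\<exists>\<Psi>. holo_on (\<Phi> ` U) \<Psi> \<and> (\<forall>x\<in>U. \<Psi> (\<Phi> x) = x))"

definition convexifiable :: "(complex ^ 'n) set \<Rightarrow> bool" where
  "convexifiable \<Omega> \<longleftrightarrow> (\<forall>p\<in>frontier \<Omega>. \<exists>U \<Phi>. open U \<and> p \<in> U \<and> biholo_onto_open U \<Phi> \<and>
      convex (\<Phi> ` (\<Omega> \<inter> U)))"

definition kob_royden :: "(complex ^ 'n) set \<Rightarrow> complex ^ 'n \<Rightarrow> complex ^ 'n \<Rightarrow> real" where
  "kob_royden \<Omega> x v = Inf {cmod \<alpha> | \<alpha>. \<exists>f :: complex \<Rightarrow> complex ^ 'n.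
      (\<forall>i. (\<lambda>z. f z $ i) holomorphic_on ball 0 1) \<and> f ` ball 0 1 \<subseteq> \<Omega> \<and> f 0 = x \<and>
      (\<chi> i. \<alpha> * deriv (\<lambda>z. f z $ i) 0) = v}"

text \<open>Kobayashi distance as the integrated form of the Kobayashi--Royden metric
  (equal to the Kobayashi distance by Royden's theorem).\<close>

definition kob_length :: "(complex ^ 'n) set \<Rightarrow> (real \<Rightarrow> complex ^ 'n) \<Rightarrow> ennreal" where
  "kob_length \<Omega> \<gamma> = (\<integral>\<^sup>+ t. ennreal (kob_royden \<Omega> (\<gamma> t) (vector_derivative \<gamma> (at t)))
      * indicator {0..1} t \<partial>lborel)"

definition kob_dist :: "(complex ^ 'n) set \<Rightarrow> complex ^ 'n \<Rightarrow> complex ^ 'n \<Rightarrow> real" where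
  "kob_dist \<Omega> x y = enn2real (INF \<gamma> \<in> {\<gamma>. \<gamma> piecewise_C1_differentiable_on {0..1} \<and>
      \<gamma> ` {0..1} \<subseteq> \<Omega> \<and> \<gamma> 0 = x \<and> \<gamma> 1 = y}. kob_length \<Omega> \<gamma>)"

definition dini_continuous_on :: "'a::metric_space set \<Rightarrow> ('a \<Rightarrow> 'b::metric_space) \<Rightarrow> bool" where
  "dini_continuous_on S f \<longleftrightarrow> (\<exists>w :: real \<Rightarrow> real.
      (\<forall>s t. 0 \<le> s \<longrightarrow> s \<le> t \<longrightarrow> w s \<le> w t) \<and> (\<forall>t\<ge>0. 0 \<le> w t) \<and>
      (\<lambda>t. w t / t) integrable_on {0<..1} \<and>
      (\<forall>p\<in>S. \<forall>q\<in>S. dist (f p) (f q) \<le> w (dist p q)))"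

definition dini_smooth_boundary :: "(complex ^ 'n) set \<Rightarrow> bool" where
  "dini_smooth_boundary \<Omega> \<longleftrightarrow> (\<forall>p\<in>frontier \<Omega>. \<exists>U \<rho> g. open U \<and> p \<in> U \<and>
      (\<forall>q\<in>U. (\<rho> has_derivative (\<lambda>v. g q \<bullet> v)) (at q) \<and> g q \<noteq> 0) \<and> continuous_on U g \<and>
      \<Omega> \<inter> U = {q\<in>U. \<rho> q < 0} \<and>
      (\<exists>r>0. dini_continuous_on (frontier \<Omega> \<inter> ball p r) (\<lambda>q. - (g q /\<^sub>R norm (g q)))))"

definition strongly_goldilocks :: "(complex ^ 'n) set \<Rightarrow> bool" where
  "strongly_goldilocks \<Omega> \<longleftrightarrow> bounded \<Omega> \<and> dini_smooth_boundary \<Omega> \<and>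
    (\<exists>c0 > 0. \<exists>\<omega> :: real \<Rightarrow> real. (\<forall>t>0. \<omega> t > 0) \<and>
      (\<forall>x\<in>\<Omega>. \<forall>v. kob_royden \<Omega> x v \<ge> c0 * norm v / \<omega> (bdist \<Omega> x)) \<and>
      (\<forall>s t. 0 < s \<longrightarrow> s \<le> t \<longrightarrow> \<omega> t / t \<le> \<omega> s / s) \<and>
      (\<forall>s t. 0 < s \<longrightarrow> s \<le> t \<longrightarrow> \<omega> s * ln (\<omega> s / s) \<le> \<omega> t * ln (\<omega> t / t)) \<and>
      (\<forall>\<epsilon>>0. (\<lambda>t. (\<omega> t / t) * ln (\<omega> t / t)) integrable_on {0<..\<epsilon>}))"

end

(*
A convexifying chart turns a supporting hyperplane at a nearest boundary point of x into a
holomorphic function h near x with Re h > 0, delta <= C Re h, and Re h(x) <= C delta(x). The lower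
bound on the Kobayashi-Royden metric and the summability of omega over dyadic scales confine
holomorphic discs centred at z: restricted to radius 1 - B delta(z) they stay in the chart. The
Schwarz lemma for the half-plane, applied to h on such a disc, shows that the metric dominates
|d((1/2) ln w)| with w = Re h / (1 + K Re h), where K absorbs the loss in radius. Integrating
along a path that stays in the chart gives the estimate. A path that leaves the chart must, while
w passes through the levels 2^j w(x), either double w or travel a distance comparable to omega at
that scale. Each such event costs length at least (1/2) ln 2, and since the distances are
summable, about log2(1/delta(x)) of them occur before the exit.
*)
theory Submission
  imports Defs
begin

unbundle no fps_syntax

text \<open>The coefficient 1/2 comes from the factor 2 in the half-plane Schwarz lemma and leaves
  no room: discs cut to a fixed radius r < 1 would give only r/2. Hence the loss of radius must be
  linear in the boundary distance. As \<open>bdist\<close> is at most C * u with u =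
  \<open>Re (h z)\<close>, it becomes a factor 1 + K * u, and du / (2 * u * (1 + K * u)) is still an
  exact differential, whose primitive differs from (1/2) ln u by a bounded amount because u is
  bounded. The function \<open>h\<close> depends on the starting point x: its real part is bounded
  by a multiple of the boundary distance only at x, while the opposite comparison holds on the whole
  patch. A lower bound on length uses the first at the start and the second everywhere else. The
  constants do not depend on x, so compactness of the closure yields one c. For a nonmeasurable
  integrand the integral is a lower integral: it is superadditive and dominates the integrals of
  measurable minorants, the two properties that lower bounds on length require.\<close>

section \<open>Lower integrals and increments of paths\<close>

text \<open>No measurability of \<^term>\<open>F\<close> is assumed: the integrand of \<^const>\<open>kob_length\<close>
  is not known to be measurable.\<close>

lemma nn_integral_superadditive:
  fixes F :: "'a \<Rightarrow> ennreal"
  assumes "A \<inter> B = {}" "A \<union> B \<subseteq> C"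
  shows "(\<integral>\<^sup>+x. F x * indicator A x \<partial>M) + (\<integral>\<^sup>+x. F x * indicator B x \<partial>M)
    \<le> (\<integral>\<^sup>+x. F x * indicator C x \<partial>M)"
proof -
  let ?S = "\<lambda>A. {g. simple_function M g \<and> g \<le> (\<lambda>x. F x * indicator A x)}"
  have ne: "?S A \<noteq> {}" for A
    by (rule ex_in_conv[THEN iffD1], rule exI[of _ "\<lambda>x. 0"]) (auto simp: le_fun_def)
  have step: "integral\<^sup>S M g1 + integral\<^sup>S M g2 \<le> (\<integral>\<^sup>+x. F x * indicator C x \<partial>M)"
    if g1: "g1 \<in> ?S A" and g2: "g2 \<in> ?S B" for g1 g2
  proof -
    have "integral\<^sup>S M g1 + integral\<^sup>S M g2 = integral\<^sup>S M (\<lambda>x. g1 x + g2 x)"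
      using g1 g2 by (simp add: simple_integral_add)
    also have "\<dots> = (\<integral>\<^sup>+x. g1 x + g2 x \<partial>M)"
      using g1 g2 by (subst nn_integral_eq_simple_integral) auto
    also have "\<dots> \<le> (\<integral>\<^sup>+x. F x * indicator C x \<partial>M)"
    proof (rule nn_integral_mono)
      fix x
      have "g1 x \<le> F x * indicator A x" "g2 x \<le> F x * indicator B x"
        using g1 g2 by (auto simp: le_fun_def)
      then show "g1 x + g2 x \<le> F x * indicator C x"
        using assms by (cases "x \<in> A"; cases "x \<in> B"; cases "x \<in> C") auto
    qed
    finally show ?thesis .
  qed
  show ?thesis
    unfolding nn_integral_def[of M "\<lambda>x. F x * indicator A x"] nn_integral_def[of M "\<lambda>x. F x * indicator B x"]
    apply (subst ennreal_SUP_add_left[symmetric, OF ne])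
    apply (rule SUP_least)
    apply (subst ennreal_SUP_add_right[OF ne])
    apply (rule SUP_least)
    using step by blast
qed

text \<open>\<open>F\<close> may fail to be measurable, but \<open>g'\<close> off \<open>S\<close>
  is a pointwise limit of difference quotients of a continuous function. Its norm is therefore a
  measurable minorant of \<open>F\<close>, to which the fundamental theorem of calculus
  applies.\<close>

lemma norm_increment_le_nn_integral:
  fixes g :: "real \<Rightarrow> 'a::euclidean_space"
  assumes ab: "a \<le> b" and S: "finite S" and cont: "continuous_on {a..b} g"
    and der: "\<And>t. t \<in> {a<..<b} - S \<Longrightarrow> (g has_vector_derivative g' t) (at t)"
    and bound: "\<And>t. t \<in> {a<..<b} - S \<Longrightarrow> ennreal (norm (g' t)) \<le> F t"
  shows "ennreal (norm (g b - g a)) \<le> (\<integral>\<^sup>+t. F t * indicator {a..<b} t \<partial>lborel)"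
proof -
  define D where "D = {a<..<b} - S"
  have Dm[measurable]: "D \<in> sets borel" unfolding D_def
    by (intro borel_open open_Diff finite_imp_closed S) auto
  \<comment> \<open>Freezing \<open>g\<close> outside the interval gives a continuous function on
    the whole line, so the quotients \<open>q\<close> are defined and measurable everywhere.\<close>
  define G where "G = (\<lambda>t. g (max a (min b t)))"
  have contG: "continuous_on UNIV G"
    unfolding G_def
    by (rule continuous_on_compose2[OF cont]) (use ab in \<open>auto intro!: continuous_intros\<close>)
  have [measurable]: "G \<in> borel_measurable borel" using contG by (rule borel_measurable_continuous_onI)
  define q where "q = (\<lambda>n t. indicat_real D t *\<^sub>R (real (Suc n) *\<^sub>R (G (t + 1 / real (Suc n)) - G t)))"
  define d where "d = (\<lambda>t. indicat_real D t *\<^sub>R g' t)"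
  have lim: "(\<lambda>n. q n t) \<longlonglongrightarrow> d t" for t
  proof (cases "t \<in> D")
    case False then show ?thesis by (simp add: q_def d_def)
  next
    case True
    then have t: "a < t" "t < b" "t \<notin> S" by (auto simp: D_def)
    have "(g has_vector_derivative g' t) (at t)" using der True unfolding D_def by blast
    then have "(G has_vector_derivative g' t) (at t)"
      apply (rule has_vector_derivative_transform_within_open[of _ _ _ "{a<..<b}"])
      using t by (auto simp: G_def)
    then have "((\<lambda>h. norm (G (t + h) - G t - h *\<^sub>R g' t) / norm h) \<longlongrightarrow> 0) (at 0)"
      by (simp add: has_vector_derivative_def has_derivative_at)
    moreover have "norm (G (t + h) - G t - h *\<^sub>R g' t) / norm h = norm ((G (t + h) - G t) /\<^sub>R h - g' t)"
      if "h \<noteq> 0" for h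
    proof -
      have "(G (t + h) - G t) /\<^sub>R h - g' t = inverse h *\<^sub>R (G (t + h) - G t - h *\<^sub>R g' t)"
        using that by (simp add: scaleR_diff_right)
      then show ?thesis by (simp add: divide_inverse mult.commute)
    qed
    then have "\<forall>\<^sub>F h in at 0. norm (G (t + h) - G t - h *\<^sub>R g' t) / norm h = norm ((G (t + h) - G t) /\<^sub>R h - g' t)"
      by (auto simp: eventually_at intro: exI[of _ 1])
    ultimately have "((\<lambda>h. norm ((G (t + h) - G t) /\<^sub>R h - g' t)) \<longlongrightarrow> 0) (at 0)"
      by (rule Lim_transform_eventually)
    then have l: "((\<lambda>h. (G (t + h) - G t) /\<^sub>R h) \<longlongrightarrow> g' t) (at 0)"
      by (rule LIM_zero_cancel[OF tendsto_norm_zero_cancel])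
    have "filterlim (\<lambda>n. 1 / real (Suc n)) (at 0) sequentially"
      unfolding filterlim_at using LIMSEQ_inverse_real_of_nat by (simp add: inverse_eq_divide)
    from filterlim_compose[OF l this] True show ?thesis
      by (simp add: q_def d_def)
  qed
  have qm: "q n \<in> borel_measurable borel" for n unfolding q_def by measurable
  have dm[measurable]: "d \<in> borel_measurable borel"
    by (rule borel_measurable_LIMSEQ_metric[OF qm lim])
  have ni: "(\<integral>\<^sup>+t. ennreal (norm (d t)) \<partial>lborel) \<le> (\<integral>\<^sup>+t. F t * indicator {a..<b} t \<partial>lborel)"
    by (rule nn_integral_mono) (use bound in \<open>auto simp: d_def D_def indicator_def\<close>)
  \<comment> \<open>An infinite integral of \<open>norm (d t)\<close> makes the claim trivial. A
    finite one makes \<open>d\<close> Lebesgue integrable, and uniqueness of the gauge integral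
    identifies its integral with the increment.\<close>
  show ?thesis
  proof (cases "(\<integral>\<^sup>+t. ennreal (norm (d t)) \<partial>lborel) = \<infinity>")
    case True
    then show ?thesis using ni by (simp add: top_unique)
  next
    case False
    then have int: "integrable lborel d"
      by (intro integrableI_bounded) (auto simp: top.not_eq_extremum)
    have "(d has_integral (\<integral>t. d t \<partial>lborel)) UNIV" using has_integral_integral_lborel[OF int] .
    then have *: "(d has_integral (\<integral>t. d t \<partial>lborel)) {a..b}"
      apply (subst has_integral_restrict_UNIV[symmetric])
      apply (erule has_integral_eq[rotated])
      by (auto simp: d_def D_def)
    have "(d has_integral (g b - g a)) {a..b}"
      apply (rule fundamental_theorem_of_calculus_interior_strong[OF S ab _ cont])
      using der by (auto simp: d_def D_def)
    with * have "g b - g a = (\<integral>t. d t \<partial>lborel)" by (metis has_integral_unique)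
    then have "ennreal (norm (g b - g a)) \<le> (\<integral>\<^sup>+t. ennreal (norm (d t)) \<partial>lborel)"
      using integral_norm_bound_ennreal[OF int] by simp
    then show ?thesis using ni by simp
  qed
qed

section \<open>Goldilocks weights and their dyadic sums\<close>

text \<open>The logarithm in the weight may have either sign. If \<open>w s < s\<close> and
  \<open>t \<le> w t\<close>, the decreasing ratio forces \<open>t \<le> s\<close>, and the log
  weight would drop from a nonnegative value at t to a negative one at s.\<close>

lemma dini_weight_dichotomy:
  fixes w :: "real \<Rightarrow> real"
  assumes pos: "\<And>t. 0 < t \<Longrightarrow> 0 < w t"
    and dec: "\<And>s t. 0 < s \<Longrightarrow> s \<le> t \<Longrightarrow> w t / t \<le> w s / s"
    and inc: "\<And>s t. 0 < s \<Longrightarrow> s \<le> t \<Longrightarrow> w s * ln (w s / s) \<le> w t * ln (w t / t)"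
  shows "(\<forall>t>0. w t < t) \<or> (\<forall>t>0. t \<le> w t)"
proof (rule ccontr)
  assume "\<not> ?thesis"
  then obtain s t where s: "s > 0" "w s < s" and t: "t > 0" "w t \<ge> t" by force
  have rs: "w s / s < 1" "0 < w s / s" and rt: "w t / t \<ge> 1"
    using s t pos[of s] by (auto simp: field_simps)
  have "t \<le> s" using dec[of s t] s t rs rt by (cases "t \<le> s") auto
  then have "w t * ln (w t / t) \<le> w s * ln (w s / s)" using inc t by blast
  moreover have "w t * ln (w t / t) \<ge> 0" using rt pos[of t] t by simp
  moreover have "w s * ln (w s / s) < 0" using rs pos[of s] s by (simp add: mult_pos_neg)
  ultimately show False by simp
qed

text \<open>Were \<open>w t < w s\<close>, the first factor of the log weight would drop strictly
  from s to t, while the second, the logarithm of a decreasing ratio that is positive at s, would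
  not grow. Their product would then decrease.\<close>

lemma mono_of_log_weight:
  fixes w :: "real \<Rightarrow> real"
  assumes ge: "\<And>t. 0 < t \<Longrightarrow> t \<le> w t"
    and dec: "\<And>s t. 0 < s \<Longrightarrow> s \<le> t \<Longrightarrow> w t / t \<le> w s / s"
    and inc: "\<And>s t. 0 < s \<Longrightarrow> s \<le> t \<Longrightarrow> w s * ln (w s / s) \<le> w t * ln (w t / t)"
    and st: "0 < s" "s \<le> t"
  shows "w s \<le> w t"
proof (rule ccontr)
  assume "\<not> w s \<le> w t"
  then have lt: "w t < w s" by simp
  have t: "0 < t" using st by simp
  have rt: "1 \<le> w t / t" using ge[OF t] t by simp
  have r: "w t / t \<le> w s / s" using dec[OF st] .
  then have rs: "1 < w s / s" using lt ge[OF t] st by (auto simp: field_simps)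
  have "w t * ln (w t / t) \<le> w t * ln (w s / s)"
    using r rt ge[OF t] t by (intro mult_left_mono ln_mono) auto
  also have "\<dots> < w s * ln (w s / s)" using lt rs by (intro mult_strict_right_mono) auto
  also have "\<dots> \<le> w t * ln (w t / t)" using inc st by blast
  finally show False by simp
qed

text \<open>A sum over dyadic scales is compared with an integral in dt/t: the increasing log weight
  at s is at most twice its integral over [s, 2s], and \<open>w s\<close> exceeds it by at most 3 *
  s. Both bounds telescope, and the threshold \<epsilon> is independent of the starting
  scale.\<close>

lemma dyadic_sums_small_of_log_weight:
  fixes w :: "real \<Rightarrow> real"
  assumes ge: "\<And>t. 0 < t \<Longrightarrow> t \<le> w t"
    and inc: "\<And>s t. 0 < s \<Longrightarrow> s \<le> t \<Longrightarrow> w s * ln (w s / s) \<le> w t * ln (w t / t)"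
    and int: "(\<lambda>t. (w t / t) * ln (w t / t)) integrable_on {0<..1}"
    and \<eta>: "0 < \<eta>"
  shows "\<exists>\<epsilon>>0. \<forall>a>0. \<exists>K::nat. (\<Sum>i<K. w (a * 2 ^ i)) \<le> \<eta> \<and> \<epsilon> < a * 2 ^ K"
proof -
  define G where "G = (\<lambda>t. w t * ln (w t / t))"
  define g where "g = (\<lambda>t. (w t / t) * ln (w t / t))"
  define I where "I = (\<lambda>x. integral {0..x} g)"
  have gG: "g t = G t / t" for t by (simp add: g_def G_def)
  have gi: "g integrable_on {0..1}"
    apply (rule integrable_spike_set[OF int[folded g_def]])
    by (auto intro: negligible_subset[of "{0::real}"])
  have contI: "continuous_on {0..1} I" unfolding I_def by (rule indefinite_integral_continuous_1[OF gi])
  have G0: "0 \<le> G t" if "0 < t" for t using ge[OF that] that unfolding G_def by (intro mult_nonneg_nonneg) auto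
  have gsub: "g integrable_on {a..b}" if "0 \<le> a" "b \<le> 1" for a b
    by (rule integrable_on_subinterval[OF gi]) (use that in auto)
  \<comment> \<open>Either the ratio \<open>w s / s\<close> is at most 3, or it exceeds e and its
    logarithm is at least 1.\<close>
  have wle: "w s \<le> 3 * s + G s" if s: "0 < s" for s
  proof (cases "w s / s \<le> 3")
    case True
    then show ?thesis using G0[OF s] s by (simp add: field_simps)
  next
    case False
    have "exp 1 \<le> (3::real)" using exp_le .
    also have "\<dots> \<le> w s / s" using False by simp
    finally have "1 \<le> ln (w s / s)" using False by (subst ln_ge_iff) auto
    then have "w s * 1 \<le> G s" unfolding G_def using ge[OF s] s by (intro mult_left_mono) auto
    then show ?thesis using s by simp
  qed
  have Gstep: "G s \<le> 2 * (I (2 * s) - I s)" if s: "0 < s" "2 * s \<le> 1" for s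
  proof -
    have "I s + integral {s..2 * s} g = I (2 * s)"
      unfolding I_def by (rule Henstock_Kurzweil_Integration.integral_combine) (use s gsub in auto)
    moreover have "integral {s..2 * s} (\<lambda>t. G s / (2 * s)) \<le> integral {s..2 * s} g"
    proof (rule integral_le)
      fix t assume t: "t \<in> {s..2 * s}"
      then show "G s / (2 * s) \<le> g t"
        unfolding gG using inc[of s t] s G0[of t] G0[of s]
        by (intro frac_le) (auto simp: G_def)
    qed (use s gsub in auto)
    ultimately show ?thesis using s by (simp add: field_simps)
  qed
  have I0: "I 0 = 0" by (simp add: I_def)
  obtain d where d: "d > 0" "\<And>x. x \<in> {0..1} \<Longrightarrow> dist x 0 < d \<Longrightarrow> dist (I x) (I 0) < \<eta> / 4"
    using contI \<eta> unfolding continuous_on_iff by (metis atLeastAtMost_iff divide_pos_pos order_refl zero_le_one zero_less_numeral)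
  \<comment> \<open>The geometric part 3 * x0 and the integral part 2 * I each receive half of
    \<eta>.\<close>
  define x0 where "x0 = min (min 1 (d / 2)) (\<eta> / 6)"
  have x0: "x0 > 0" "x0 \<le> 1" "x0 < d" "3 * x0 \<le> \<eta> / 2" using d \<eta> by (auto simp: x0_def min_def)
  have sum: "(\<Sum>i<K. w (a * 2 ^ i)) \<le> 3 * (a * 2 ^ K) + 2 * (I (a * 2 ^ K) - I a)"
    if a: "a > 0" "a * 2 ^ K \<le> 1" for a and K :: nat
    using a(2)
  proof (induction K)
    case 0
    then show ?case using a by simp
  next
    case (Suc K)
    have p: "0 < a * 2 ^ K" using a by simp
    have "a * 2 ^ K \<le> 1" using Suc.prems p by simp
    note IH = Suc.IH[OF this]
    have "w (a * 2 ^ K) \<le> 3 * (a * 2 ^ K) + 2 * (I (2 * (a * 2 ^ K)) - I (a * 2 ^ K))"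
      using wle[OF p] Gstep[OF p] Suc.prems by (simp add: mult.left_commute)
    then show ?case using IH by (simp add: algebra_simps)
  qed
  have Ia: "0 \<le> I a" if "0 < a" "a \<le> 1" for a
    unfolding I_def
  proof (rule integral_nonneg)
    show "g integrable_on {0..a}" using gsub that by auto
    show "0 \<le> g t" if "t \<in> {0..a}" for t
      using that G0[of t] by (cases "t = 0") (auto simp: gG)
  qed
  show ?thesis
  proof (intro exI[of _ "x0 / 2"] conjI allI impI)
    fix a :: real assume a: "a > 0"
    show "\<exists>K::nat. (\<Sum>i<K. w (a * 2 ^ i)) \<le> \<eta> \<and> x0 / 2 < a * 2 ^ K"
    proof (cases "a \<le> x0")
      case False
      then show ?thesis using \<eta> x0 by (intro exI[of _ 0]) auto
    next
      case True
      obtain n0 :: nat where "x0 / a < 2 ^ n0" using real_arch_pow[of 2 "x0 / a"] by auto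
      then have ex: "\<exists>n::nat. x0 < a * 2 ^ n" using a by (auto simp: field_simps)
      \<comment> \<open>\<open>n\<close> is the first exponent with a * 2 ^ n beyond x0, and K = n -
        1 is used: the top scale is then at most x0 but above x0 / 2, the \<epsilon> fixed for all
        a.\<close>
      define n where "n = (LEAST n::nat. x0 < a * 2 ^ n)"
      have n: "x0 < a * 2 ^ n" unfolding n_def using ex by (rule LeastI_ex)
      have "n \<noteq> 0" using n True by (metis leD mult.right_neutral power_0)
      then obtain K where K: "n = Suc K" using not0_implies_Suc by blast
      have le: "a * 2 ^ K \<le> x0" using not_less_Least[of K "\<lambda>n. x0 < a * 2 ^ n"] K n_def by auto
      have "dist (I (a * 2 ^ K)) (I 0) < \<eta> / 4"
        using a le x0 by (intro d) auto
      then have "I (a * 2 ^ K) < \<eta> / 4" by (simp add: I0)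
      moreover have "0 \<le> I a" using Ia a True x0 by simp
      moreover have "(\<Sum>i<K. w (a * 2 ^ i)) \<le> 3 * (a * 2 ^ K) + 2 * (I (a * 2 ^ K) - I a)"
        using sum a le x0 by auto
      moreover have "3 * (a * 2 ^ K) \<le> \<eta> / 2" using le x0(4) by (meson order_trans mult_left_mono zero_le_numeral)
      ultimately have "(\<Sum>i<K. w (a * 2 ^ i)) \<le> \<eta>" by (simp add: algebra_simps)
      moreover have "x0 / 2 < a * 2 ^ K" using n K by simp
      ultimately show ?thesis by blast
    qed
  qed (use x0 in simp)
qed

text \<open>Enlarging the weight only weakens a lower bound on the metric, so a monotone majorant
  may replace it. When \<open>w\<close> lies below the identity the substitute is e * t: its ratio
  is e, its logarithm 1, and its log weight e * t again.\<close>

lemma dini_majorant: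
  fixes w :: "real \<Rightarrow> real"
  assumes pos: "\<And>t. 0 < t \<Longrightarrow> 0 < w t"
    and dec: "\<And>s t. 0 < s \<Longrightarrow> s \<le> t \<Longrightarrow> w t / t \<le> w s / s"
    and inc: "\<And>s t. 0 < s \<Longrightarrow> s \<le> t \<Longrightarrow> w s * ln (w s / s) \<le> w t * ln (w t / t)"
    and int: "(\<lambda>t. (w t / t) * ln (w t / t)) integrable_on {0<..1}"
  obtains W where "\<And>t. 0 < t \<Longrightarrow> w t \<le> W t" "\<And>t. 0 < t \<Longrightarrow> 0 < W t"
    "\<And>s t. 0 < s \<Longrightarrow> s \<le> t \<Longrightarrow> W s \<le> W t"
    "\<And>\<eta>. 0 < \<eta> \<Longrightarrow> \<exists>\<epsilon>>0. \<forall>a>0. \<exists>K::nat. (\<Sum>i<K. W (a * 2 ^ i)) \<le> \<eta> \<and> \<epsilon> < a * 2 ^ K"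
proof (cases "\<forall>t>0. t \<le> w t")
  case True
  show ?thesis
    by (rule that[of w]) (use pos True mono_of_log_weight[of w] dyadic_sums_small_of_log_weight[of w] dec inc int in auto)
next
  case False
  then have lt: "\<forall>t>0. w t < t" using dini_weight_dichotomy[of w] pos dec inc by blast
  define e where "e = exp (1::real)"
  have e1: "1 \<le> e" "e > 0" by (auto simp: e_def)
  have r: "e * t / t = e" if "0 < t" for t using that by simp
  show ?thesis
  proof (rule that[of "\<lambda>t. e * t"])
    show "w t \<le> e * t" if "0 < t" for t using lt that e1 by (smt (verit) mult_le_cancel_right1)
    fix \<eta> :: real assume \<eta>: "0 < \<eta>"
    have "(\<lambda>t. e * ln e) integrable_on {0<..1::real}"
      by (rule integrable_spike_set[of _ "{0..1}"]) (auto intro: negligible_subset[of "{0::real}"])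
    then have i: "(\<lambda>t. (e * t / t) * ln (e * t / t)) integrable_on {0<..1}"
      by (rule integrable_eq) auto
    show "\<exists>\<epsilon>>0. \<forall>a>0. \<exists>K::nat. (\<Sum>i<K. e * (a * 2 ^ i)) \<le> \<eta> \<and> \<epsilon> < a * 2 ^ K"
      by (rule dyadic_sums_small_of_log_weight[OF _ _ i \<eta>]) (use e1 in \<open>auto simp: e_def mult_le_cancel_right1\<close>)
  qed (use e1 in auto)
qed

section \<open>Schwarz lemma for the right half-plane\<close>

text \<open>The Cayley transform centred at \<open>h 0\<close> carries the half-plane to the unit
  disc, where the classical Schwarz lemma gives both bounds. The radius is free because discs are
  cut down before a supporting function is applied to them.\<close>

lemma half_plane_Schwarz:
  assumes hol: "h holomorphic_on ball 0 r" and r: "0 < r"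
    and pos: "\<And>z. cmod z < r \<Longrightarrow> 0 < Re (h z)"
  shows "cmod z < r \<Longrightarrow> Re (h z) \<le> Re (h 0) * ((r + cmod z) / (r - cmod z))"
    and "cmod (deriv h 0) \<le> 2 * Re (h 0) / r"
proof -
  define a where "a = Re (h 0)"
  have a: "a > 0" using pos[of 0] r by (simp add: a_def)
  have nz: "h z + cnj (h 0) \<noteq> 0" if "cmod z < r" for z
    using pos[OF that] a by (auto simp: complex_eq_iff a_def)
  define F where "F = (\<lambda>\<zeta>. (h (of_real r * \<zeta>) - h 0) / (h (of_real r * \<zeta>) + cnj (h 0)))"
  have mem: "cmod (of_real r * \<zeta>) < r" if "cmod \<zeta> < 1" for \<zeta>
    using that r by (simp add: norm_mult)
  have hr: "(\<lambda>\<zeta>. h (of_real r * \<zeta>)) holomorphic_on ball 0 1"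
    by (rule holomorphic_on_compose_gen[OF _ hol, unfolded o_def])
      (use mem in \<open>auto intro!: holomorphic_intros\<close>)
  have F: "F holomorphic_on ball 0 1" unfolding F_def
    by (intro holomorphic_intros hr) (use nz mem in auto)
  have F0: "F 0 = 0" by (simp add: F_def)
  have F1: "cmod (F \<zeta>) < 1" if "cmod \<zeta> < 1" for \<zeta>
  proof -
    let ?w = "h (of_real r * \<zeta>)"
    have "0 < Re ?w" using pos mem that by blast
    then have "(Re ?w - a)\<^sup>2 < (Re ?w + a)\<^sup>2" using a by (simp add: power2_eq_square algebra_simps)
    then have "(cmod (?w - h 0))\<^sup>2 < (cmod (?w + cnj (h 0)))\<^sup>2" by (simp add: cmod_power2 a_def)
    then have "cmod (?w - h 0) < cmod (?w + cnj (h 0))" by (simp add: power_less_imp_less_base)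
    then show ?thesis using nz[OF mem[OF that]] by (simp add: F_def norm_divide)
  qed
  {
    assume z: "cmod z < r"
    define \<rho> where "\<rho> = cmod z / r"
    have \<rho>: "0 \<le> \<rho>" "\<rho> < 1" using z r by (auto simp: \<rho>_def)
    have zz: "cmod (z / of_real r) < 1" using z r by (simp add: norm_divide)
    have "cmod (F (z / of_real r)) \<le> \<rho>"
      using Schwarz_Lemma(1)[OF F F0 F1 zz] r by (simp add: \<rho>_def norm_divide)
    then have le: "cmod (h z - h 0) \<le> \<rho> * cmod (h z + cnj (h 0))"
      using nz[OF z] r by (simp add: F_def norm_divide field_simps)
    have "(cmod (h z - h 0))\<^sup>2 \<le> (\<rho> * cmod (h z + cnj (h 0)))\<^sup>2"
      using le by (rule power_mono) simp
    then have "(Re (h z) - a)\<^sup>2 + (Im (h z) - Im (h 0))\<^sup>2 \<le> \<rho>\<^sup>2 * (Re (h z) + a)\<^sup>2 + \<rho>\<^sup>2 * (Im (h z) - Im (h 0))\<^sup>2"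
      by (simp add: power_mult_distrib cmod_power2 a_def algebra_simps)
    \<comment> \<open>The increment of the imaginary part can be cancelled from the inequality,
      because its coefficient on the right is below 1.\<close>
    moreover have "\<rho>\<^sup>2 * (Im (h z) - Im (h 0))\<^sup>2 \<le> 1 * (Im (h z) - Im (h 0))\<^sup>2"
      using \<rho> by (intro mult_right_mono) (auto simp: power_le_one)
    ultimately have "(Re (h z) - a)\<^sup>2 \<le> (\<rho> * (Re (h z) + a))\<^sup>2" by (simp add: power_mult_distrib)
    then have "Re (h z) - a \<le> \<rho> * (Re (h z) + a)"
      using \<rho> a pos[OF z] by (intro power2_le_imp_le[of "Re (h z) - a"]) auto
    then have "Re (h z) * (1 - \<rho>) \<le> a * (1 + \<rho>)" by (simp add: algebra_simps)
    then have "Re (h z) \<le> a * ((1 + \<rho>) / (1 - \<rho>))" using \<rho> by (simp add: field_simps)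
    also have "(1 + \<rho>) / (1 - \<rho>) = (r + cmod z) / (r - cmod z)"
      using r z by (simp add: \<rho>_def field_simps)
    finally show "Re (h z) \<le> Re (h 0) * ((r + cmod z) / (r - cmod z))" by (simp add: a_def)
  }
  have dh: "(h has_field_derivative deriv h 0) (at (of_real r * 0))"
    using holomorphic_derivI[OF hol, of 0] r by simp
  have "((\<lambda>\<zeta>. h (of_real r * \<zeta>)) has_field_derivative deriv h 0 * of_real r) (at 0)"
    by (rule DERIV_chain2[where f = h and g = "\<lambda>\<zeta>. of_real r * \<zeta>", OF dh]) (auto intro!: derivative_eq_intros)
  note dhr = this
  have s2: "h 0 + cnj (h 0) = 2 * of_real a" using complex_add_cnj[of "h 0"] by (simp add: a_def)
  have "((\<lambda>\<zeta>. h (of_real r * \<zeta>) - h 0) has_field_derivative deriv h 0 * of_real r) (at 0)"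
    "((\<lambda>\<zeta>. h (of_real r * \<zeta>) + cnj (h 0)) has_field_derivative deriv h 0 * of_real r) (at 0)"
    using DERIV_diff[OF dhr DERIV_const[of "h 0"]] DERIV_add[OF dhr DERIV_const[of "cnj (h 0)"]] by simp_all
  from DERIV_divide[OF this]
  have "(F has_field_derivative (deriv h 0 * of_real r) / (2 * of_real a)) (at 0)"
    unfolding F_def using s2 a by (simp add: field_simps)
  then have "deriv F 0 = (deriv h 0 * of_real r) / (2 * of_real a)" by (rule DERIV_imp_deriv)
  moreover have "cmod (deriv F 0) \<le> 1" using Schwarz_Lemma(2)[OF F F0 F1, of 0] by simp
  ultimately show "cmod (deriv h 0) \<le> 2 * Re (h 0) / r"
    using a r by (simp add: norm_divide norm_mult a_def field_simps)
qed

section \<open>Holomorphic discs and the Kobayashi-Royden metric\<close>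

lemma norm_cvec_scale: "norm (c *s (v :: complex ^ 'n)) = cmod c * norm v"
  by (simp add: norm_vec_def norm_mult L2_set_right_distrib)

definition holo_disc :: "(complex ^ 'n) set \<Rightarrow> (complex \<Rightarrow> complex ^ 'n) \<Rightarrow> bool" where
  "holo_disc \<Omega> f \<longleftrightarrow> (\<forall>i. (\<lambda>z. f z $ i) holomorphic_on ball 0 1) \<and> f ` ball 0 1 \<subseteq> \<Omega>"

definition cderiv :: "(complex \<Rightarrow> complex ^ 'n) \<Rightarrow> complex \<Rightarrow> complex ^ 'n" where
  "cderiv f z = (\<chi> i. deriv (\<lambda>z. f z $ i) z)"

lemma kob_royden_alt:
  "kob_royden \<Omega> x v = Inf {cmod \<alpha> | \<alpha>. \<exists>f. holo_disc \<Omega> f \<and> f 0 = x \<and> \<alpha> *s cderiv f 0 = v}"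
  unfolding kob_royden_def holo_disc_def cderiv_def vector_scalar_mult_def by simp

lemma kob_royden_le:
  assumes "holo_disc \<Omega> f" "f 0 = x" "\<alpha> *s cderiv f 0 = v"
  shows "kob_royden \<Omega> x v \<le> cmod \<alpha>"
  unfolding kob_royden_alt using assms
  by (intro cInf_lower) (auto intro!: bdd_belowI[of _ 0])

lemma affine_holo_disc:
  fixes x :: "complex ^ 'n"
  assumes r: "0 < r" "ball x r \<subseteq> \<Omega>" and u: "norm u \<le> r"
  shows "holo_disc \<Omega> (\<lambda>z. x + z *s u)" "cderiv (\<lambda>z. x + z *s u) 0 = u"
proof -
  have "norm (z *s u) < r" if "cmod z < 1" for z
    using mult_strict_mono'[of "cmod z" 1 "norm u" "r"] that u r
    by (cases "norm u = r") (auto simp: norm_cvec_scale intro: mult_left_le_one_le le_less_trans[of _ "norm u"])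
  then have "x + z *s u \<in> \<Omega>" if "cmod z < 1" for z
    using that r by (auto simp: dist_norm intro!: subsetD[OF r(2)])
  then show "holo_disc \<Omega> (\<lambda>z. x + z *s u)"
    by (auto simp: holo_disc_def intro!: holomorphic_intros)
  have "deriv (\<lambda>z. x $ i + z * u $ i) 0 = u $ i" for i
    by (rule DERIV_imp_deriv) (auto intro!: derivative_eq_intros)
  then show "cderiv (\<lambda>z. x + z *s u) 0 = u" by (simp add: cderiv_def vec_eq_iff)
qed

lemma kob_royden_le_norm:
  assumes r: "0 < r" "ball x r \<subseteq> \<Omega>"
  shows "kob_royden \<Omega> x v \<le> norm v / r"
proof -
  \<comment> \<open>For v = 0 division by zero gives u = 0, and the constant disc is the
    witness.\<close>
  define u where "u = of_real (r / norm v) *s v"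
  have "norm u \<le> r" using r by (simp add: u_def norm_cvec_scale norm_divide)
  note d = affine_holo_disc[OF r this]
  have "of_real (norm v / r) *s u = v"
    using r by (cases "v = 0") (auto simp: u_def vec_eq_iff)
  then have "kob_royden \<Omega> x v \<le> cmod (of_real (norm v / r))"
    using kob_royden_le[OF d(1), of x "of_real (norm v / r)" v] d(2) by simp
  also have "\<dots> = norm v / r" using r by (simp add: norm_divide)
  finally show ?thesis .
qed

text \<open>The infimum of an empty set of reals is unspecified, so bounding every competitor from
  below does not suffice. Openness supplies an affine disc that makes the set nonempty.\<close>

lemma kob_royden_ge:
  assumes "open \<Omega>" "x \<in> \<Omega>"
    and "\<And>f \<alpha>. holo_disc \<Omega> f \<Longrightarrow> f 0 = x \<Longrightarrow> \<alpha> *s cderiv f 0 = v \<Longrightarrow> C \<le> cmod \<alpha>"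
  shows "C \<le> kob_royden \<Omega> x v"
  unfolding kob_royden_alt
proof (rule cInf_greatest)
  obtain r where r: "0 < r" "ball x r \<subseteq> \<Omega>" using assms open_contains_ball by blast
  define u where "u = of_real (r / norm v) *s v"
  have "norm u \<le> r" using r by (simp add: u_def norm_cvec_scale norm_divide)
  note d = affine_holo_disc[OF r this]
  have "of_real (norm v / r) *s cderiv (\<lambda>z. x + z *s u) 0 = v"
    using r d(2) by (cases "v = 0") (auto simp: u_def vec_eq_iff)
  then show "{cmod \<alpha> | \<alpha>. \<exists>f. holo_disc \<Omega> f \<and> f 0 = x \<and> \<alpha> *s cderiv f 0 = v} \<noteq> {}"
    using d(1) by fastforce
qed (use assms in blast)

text \<open>Recentring uses the affine map onto the disc of radius 1 - |\<zeta>| about \<zeta> in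
  place of a Moebius map with its factor 1 / (1 - |\<zeta>|^2). The loss is at most a factor 2 and
  enters only the constants that confine discs.\<close>

lemma kob_royden_disc_le:
  assumes f: "holo_disc \<Omega> f" and z: "cmod \<zeta> < 1"
  shows "kob_royden \<Omega> (f \<zeta>) (cderiv f \<zeta>) \<le> 1 / (1 - cmod \<zeta>)"
proof -
  define s where "s = 1 - cmod \<zeta>"
  have s: "s > 0" using z by (simp add: s_def)
  define g where "g = (\<lambda>z. f (\<zeta> + of_real s * z))"
  have mem: "cmod (\<zeta> + of_real s * z) < 1" if "cmod z < 1" for z
  proof -
    have "cmod (\<zeta> + of_real s * z) \<le> cmod \<zeta> + s * cmod z"
      using norm_triangle_ineq[of \<zeta> "of_real s * z"] s by (simp add: norm_mult)
    also have "\<dots> < cmod \<zeta> + s * 1" using s that by simp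
    finally show ?thesis by (simp add: s_def)
  qed
  have hf: "(\<lambda>z. f z $ i) holomorphic_on ball 0 1" for i using f by (simp add: holo_disc_def)
  have hg: "(\<lambda>z. g z $ i) holomorphic_on ball 0 1" for i
    unfolding g_def
    by (rule holomorphic_on_compose_gen[OF _ hf, unfolded o_def])
      (use mem in \<open>auto intro!: holomorphic_intros\<close>)
  have "holo_disc \<Omega> g" using hg f mem by (auto simp: holo_disc_def g_def)
  moreover have "deriv (\<lambda>z. g z $ i) 0 = deriv (\<lambda>z. f z $ i) \<zeta> * of_real s" for i
  proof (rule DERIV_imp_deriv)
    have "((\<lambda>z. f z $ i) has_field_derivative deriv (\<lambda>z. f z $ i) \<zeta>) (at (\<zeta> + of_real s * 0))"
      using holomorphic_derivI[OF hf, of \<zeta>] z by simp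
    then show "((\<lambda>z. g z $ i) has_field_derivative deriv (\<lambda>z. f z $ i) \<zeta> * of_real s) (at 0)"
      unfolding g_def
      by (rule DERIV_chain2[where g = "\<lambda>z. \<zeta> + of_real s * z"]) (auto intro!: derivative_eq_intros)
  qed
  then have "of_real (1 / s) *s cderiv g 0 = cderiv f \<zeta>"
    using s by (simp add: cderiv_def vec_eq_iff)
  ultimately have "kob_royden \<Omega> (f \<zeta>) (cderiv f \<zeta>) \<le> cmod (of_real (1 / s))"
    by (intro kob_royden_le) (auto simp: g_def)
  also have "\<dots> = 1 / s" using s by (simp add: norm_divide)
  finally show ?thesis by (simp add: s_def)
qed

lemma holo_disc_has_derivative:
  fixes f :: "complex \<Rightarrow> complex ^ 'n"
  assumes "holo_disc \<Omega> f" "cmod \<zeta> < 1"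
  shows "(f has_derivative (\<lambda>h. h *s cderiv f \<zeta>)) (at \<zeta>)"
proof -
  have "((\<lambda>z. f z $ i) has_derivative (\<lambda>h. deriv (\<lambda>z. f z $ i) \<zeta> * h)) (at \<zeta>)" for i
    using assms by (auto simp: holo_disc_def intro!: holomorphic_derivI[THEN has_field_derivative_imp_has_derivative])
  then have "((\<lambda>z. f z \<bullet> axis i b) has_derivative (\<lambda>h. (h *s cderiv f \<zeta>) \<bullet> axis i b)) (at \<zeta>)" for i b
    by (simp add: inner_axis cderiv_def mult.commute has_derivative_inner_left)
  then show ?thesis
    by (subst has_derivative_componentwise_within) (auto simp: Basis_vec_def)
qed

section \<open>Distance to the boundary\<close>

lemma bdist_nonneg: "0 \<le> bdist \<Omega> x" by (simp add: bdist_def infdist_nonneg)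

lemma bdist_le_dist:
  fixes x y :: "complex ^ 'n"
  assumes "x \<in> \<Omega>" "y \<notin> \<Omega>"
  shows "bdist \<Omega> x \<le> dist x y"
proof -
  have "closed_segment x y \<inter> frontier \<Omega> \<noteq> {}"
    using assms by (intro connected_Int_frontier) auto
  then obtain q where q: "q \<in> closed_segment x y" "q \<in> frontier \<Omega>" by auto
  have "bdist \<Omega> x \<le> dist x q" unfolding bdist_def by (rule infdist_le[OF q(2)])
  also have "\<dots> \<le> dist x y" using q dist_in_closed_segment[of q x y] by (simp add: dist_commute)
  finally show ?thesis .
qed

lemma bdist_pos:
  fixes \<Omega> :: "(complex ^ 'n) set"
  assumes "open \<Omega>" "bounded \<Omega>" "x \<in> \<Omega>"
  shows "0 < bdist \<Omega> x"
proof -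
  have "\<Omega> \<noteq> UNIV" using assms not_bounded_UNIV by auto
  then have "frontier \<Omega> \<noteq> {}" using assms frontier_eq_empty by blast
  moreover have "x \<notin> frontier \<Omega>" using assms by (simp add: frontier_def interior_open)
  ultimately show ?thesis unfolding bdist_def by (simp add: infdist_pos_not_in_closed)
qed

lemma ball_bdist_subset:
  fixes \<Omega> :: "(complex ^ 'n) set"
  assumes "x \<in> \<Omega>"
  shows "ball x (bdist \<Omega> x) \<subseteq> \<Omega>"
  using bdist_le_dist[OF assms] by force

lemma bdist_lipschitz: "\<bar>bdist \<Omega> x - bdist \<Omega> y\<bar> \<le> dist x y"
  unfolding bdist_def by (rule infdist_triangle_abs)

lemma continuous_on_bdist: "continuous_on S (bdist \<Omega>)"
  unfolding bdist_def by (intro continuous_intros)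

lemma bounded_bdist:
  fixes \<Omega> :: "(complex ^ 'n) set"
  assumes "bounded \<Omega>"
  obtains M where "M > 0" "\<And>x. x \<in> \<Omega> \<Longrightarrow> bdist \<Omega> x \<le> M"
proof -
  obtain y where y: "y \<notin> \<Omega>" using assms not_bounded_UNIV[where 'a = "complex ^ 'n"] by (metis UNIV_eq_I)
  obtain M where "\<And>x. x \<in> \<Omega> \<Longrightarrow> dist y x \<le> M"
    using assms unfolding bounded_any_center[of _ y] by auto
  then show thesis using bdist_le_dist[OF _ y] by (intro that[of "max M 1"]) (force simp: dist_commute)+
qed

section \<open>Local Lipschitz bounds for holomorphic maps\<close>

lemma complex_chain_rule:
  fixes f :: "complex \<Rightarrow> complex ^ 'n"
  assumes h: "(h has_derivative h') (at (f \<zeta>))" and lin: "\<And>c v. h' (c *s v) = c * h' v"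
    and f: "(f has_derivative (\<lambda>k. k *s d)) (at \<zeta>)"
  shows "((\<lambda>\<zeta>. h (f \<zeta>)) has_field_derivative h' d) (at \<zeta>)"
proof -
  have "(\<lambda>k. h' (k *s d)) = (*) (h' d)" by (auto simp: lin mult.commute)
  then show ?thesis using has_derivative_compose[OF f h] by (simp add: has_field_derivative_def)
qed

lemma complex_line_has_derivative:
  fixes q v :: "complex ^ 'n"
  shows "((\<lambda>\<zeta>. q + \<zeta> *s v) has_derivative (\<lambda>k. k *s v)) (at \<zeta>)"
proof -
  have "linear (\<lambda>k. k *s v)"
    by (rule linearI) (auto simp: vec_eq_iff algebra_simps)
  then have "bounded_linear (\<lambda>k. k *s v)" by (simp add: linear_conv_bounded_linear)
  from has_derivative_add[OF has_derivative_const bounded_linear_imp_has_derivative[OF this]]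
  show ?thesis by simp
qed

lemma holo_on_imp_continuous_on:
  assumes "holo_on U F" shows "continuous_on U F"
  using assms unfolding holo_on_def
  by (intro continuous_at_imp_continuous_on) (blast dest: has_derivative_continuous)

text \<open>\<open>holo_on\<close> asserts a derivative at each point but no bound near p. Cauchy's
  estimate for the components of \<open>F\<close> on complex lines through q bounds the derivatives
  on a ball of half the size, and the mean value inequality on this convex ball does the
  rest.\<close>

lemma holo_on_locally_lipschitz:
  fixes F :: "complex ^ 'n \<Rightarrow> complex ^ 'm"
  assumes "open U" "p \<in> U" and F: "holo_on U F"
  obtains r L where "r > 0" "L > 0" "ball p r \<subseteq> U"
    "\<And>z w. z \<in> ball p r \<Longrightarrow> w \<in> ball p r \<Longrightarrow> norm (F z - F w) \<le> L * norm (z - w)"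
proof -
  obtain e where e: "e > 0" "cball p e \<subseteq> U" using assms open_contains_cball by blast
  have "compact (F ` cball p e)"
    by (intro compact_continuous_image continuous_on_subset[OF holo_on_imp_continuous_on[OF F] e(2)]) simp
  then obtain M where M: "M > 0" "\<And>z. z \<in> cball p e \<Longrightarrow> norm (F z) \<le> M"
    using compact_imp_bounded bounded_pos by (metis imageI)
  define r where "r = e / 2"
  have r: "r > 0" using e by (simp add: r_def)
  define L where "L = real CARD('m) * (M / r)"
  have L: "L > 0" using M r by (simp add: L_def)
  have der: "norm (T v) \<le> L * norm v"
    if q: "q \<in> ball p r" and T: "(F has_derivative T) (at q)" "complex_linear T" for q T v
  proof (cases "v = 0")
    case True
    then show ?thesis using T by (simp add: has_derivative_bounded_linear linear_simps(3))
  next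
    case False
    \<comment> \<open>Parameters of modulus at most s move q by at most r, so the disc on the line
      stays in \<open>cball p e\<close>, where e = 2 * r and \<open>F\<close> is bounded by
      M.\<close>
    define s where "s = r / norm v"
    have s: "s > 0" using r False by (simp add: s_def)
    have mem: "q + \<zeta> *s v \<in> cball p e" if "cmod \<zeta> \<le> s" for \<zeta>
    proof -
      have "norm (\<zeta> *s v) \<le> r" using that False by (simp add: norm_cvec_scale s_def field_simps)
      moreover have "norm (p - q) < r" using q by (simp add: dist_norm)
      moreover have "norm (p - q - \<zeta> *s v) \<le> norm (p - q) + norm (\<zeta> *s v)" by (rule norm_triangle_ineq4)
      ultimately show ?thesis by (simp add: dist_norm r_def algebra_simps)
    qed
    have comp: "cmod (T v $ i) \<le> M / r * norm v" for i
    proof -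
      define \<phi> where "\<phi> = (\<lambda>\<zeta>. F (q + \<zeta> *s v) $ i)"
      have d: "(\<phi> has_field_derivative T v $ i) (at \<zeta>)"
        if "(F has_derivative T) (at (q + \<zeta> *s v))" "complex_linear T" for \<zeta> T
        unfolding \<phi>_def
        using that complex_line_has_derivative
        by (intro complex_chain_rule[where h = "\<lambda>z. F z $ i" and h' = "\<lambda>v. T v $ i"])
          (auto simp: complex_linear_def intro: bounded_linear.has_derivative[OF bounded_linear_vec_nth])
      have fd: "\<exists>D. (\<phi> has_field_derivative D) (at \<zeta>)" if "cmod \<zeta> \<le> s" for \<zeta>
        using mem[OF that] e F d unfolding holo_on_def by (meson subsetD)
      have hol: "\<phi> holomorphic_on ball 0 s"
        unfolding holomorphic_on_def field_differentiable_def
        using fd has_field_derivative_at_within by (metis less_imp_le mem_ball_0)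
      have cont: "continuous_on (cball 0 s) \<phi>"
        using fd by (intro continuous_at_imp_continuous_on) (force dest: DERIV_isCont)
      have "cmod ((deriv ^^ 1) \<phi> 0) \<le> fact 1 * M / s ^ 1"
      proof (rule Cauchy_inequality[OF hol cont s])
        fix x assume "cmod (0 - x) = s"
        then have "norm (F (q + x *s v)) \<le> M" by (intro M mem) simp
        then show "cmod (\<phi> x) \<le> M"
          unfolding \<phi>_def using component_le_norm_cart order_trans Finite_Cartesian_Product.norm_nth_le by blast
      qed
      moreover have "deriv \<phi> 0 = T v $ i" using d[of T 0] T by (intro DERIV_imp_deriv) auto
      ultimately show ?thesis by (simp add: s_def field_simps)
    qed
    have "norm (T v) \<le> (\<Sum>i\<in>UNIV. norm (T v $ i))" by (simp add: norm_vec_def L2_set_le_sum)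
    also have "\<dots> \<le> (\<Sum>i\<in>(UNIV::'m set). M / r * norm v)" by (rule sum_mono) (rule comp)
    finally show ?thesis by (simp add: L_def)
  qed
  have rU: "ball p r \<subseteq> U" using e r by (auto simp: r_def subset_eq)
  have "\<forall>q\<in>ball p r. \<exists>T. (F has_derivative T) (at q) \<and> complex_linear T" using F rU unfolding holo_on_def by blast
  then obtain T where T: "\<And>q. q \<in> ball p r \<Longrightarrow> (F has_derivative T q) (at q) \<and> complex_linear (T q)" by metis
  have "norm (F z - F w) \<le> L * norm (z - w)" if zw: "z \<in> ball p r" "w \<in> ball p r" for z w
  proof (rule differentiable_bound[OF convex_ball])
    show "(F has_derivative T q) (at q within ball p r)" if "q \<in> ball p r" for q
      using T[OF that] has_derivative_at_withinI by blast
    show "onorm (T q) \<le> L" if "q \<in> ball p r" for q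
      using der[OF that] T[OF that] L by (intro onorm_bound) auto
  qed (use zw in auto)
  then show thesis using that r L rU by blast
qed

section \<open>Holomorphic supporting functions from convexity\<close>

text \<open>The pullback of a supporting linear functional through a chart. Control of
  \<open>Re (h z)\<close> by the boundary distance is available only at a chosen point and is
  therefore stated separately where it is used. Complex homogeneity is listed because
  \<open>has_derivative\<close> is a real notion; the bound by C keeps the later correction factor
  bounded.\<close>

definition support_fn ::
  "(complex ^ 'n) set \<Rightarrow> (complex ^ 'n) \<Rightarrow> real \<Rightarrow> real \<Rightarrow> (complex ^ 'n \<Rightarrow> complex) \<Rightarrow> (complex ^ 'n \<Rightarrow> complex ^ 'n \<Rightarrow> complex) \<Rightarrow> bool"
  where "support_fn \<Omega> p R C h h' \<longleftrightarrow> (\<forall>z\<in>\<Omega> \<inter> ball p R. (h has_derivative h' z) (at z) \<and>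
     (\<forall>c v. h' z (c *s v) = c * h' z v) \<and> 0 < Re (h z) \<and> bdist \<Omega> z \<le> C * Re (h z) \<and> Re (h z) \<le> C)"

lemma Re_hermitian_sum: "Re (\<Sum>i\<in>UNIV. cnj (e $ i) * v $ i) = (e :: complex ^ 'n) \<bullet> v"
  by (simp add: inner_vec_def inner_complex_def)

text \<open>The hyperplane supports the convex image at the image of a boundary point q nearest to
  x, so \<open>Re (h x)\<close> is at most L1 * |x - q|. Conversely, moving the image of z by
  \<open>Re (h z)\<close> against the normal leaves the convex set, and the Lipschitz inverse chart
  turns this into a point outside \<Omega> close to z. R and C come from the two Lipschitz balls
  alone, hence serve every x.\<close>

lemma local_support:
  fixes \<Omega> :: "(complex ^ 'n) set"
  assumes op: "open \<Omega>" and cvx: "convexifiable \<Omega>" and p: "p \<in> frontier \<Omega>"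
  obtains R C where "R > 0" "C > 0"
    "\<And>x. x \<in> \<Omega> \<Longrightarrow> x \<in> ball p R \<Longrightarrow> \<exists>h h'. support_fn \<Omega> p R C h h' \<and> Re (h x) \<le> C * bdist \<Omega> x"
proof -
  obtain U \<Phi> where U: "open U" "p \<in> U" and bi: "biholo_onto_open U \<Phi>" and conv: "convex (\<Phi> ` (\<Omega> \<inter> U))"
    using cvx p unfolding convexifiable_def by blast
  obtain \<Psi> where V: "open (\<Phi> ` U)" and inj: "inj_on \<Phi> U" and h\<Phi>: "holo_on U \<Phi>"
    and h\<Psi>: "holo_on (\<Phi> ` U) \<Psi>" and \<Psi>: "\<And>x. x \<in> U \<Longrightarrow> \<Psi> (\<Phi> x) = x"
    using bi unfolding biholo_onto_open_def by blast
  obtain r1 L1 where r1: "r1 > 0" "L1 > 0" "ball p r1 \<subseteq> U"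
    and lip1: "\<And>z w. z \<in> ball p r1 \<Longrightarrow> w \<in> ball p r1 \<Longrightarrow> norm (\<Phi> z - \<Phi> w) \<le> L1 * norm (z - w)"
    using holo_on_locally_lipschitz[OF U h\<Phi>] by metis
  have "\<Phi> p \<in> \<Phi> ` U" using U by blast
  then obtain r2 L2 where r2: "r2 > 0" "L2 > 0" "ball (\<Phi> p) r2 \<subseteq> \<Phi> ` U"
    and lip2: "\<And>z w. z \<in> ball (\<Phi> p) r2 \<Longrightarrow> w \<in> ball (\<Phi> p) r2 \<Longrightarrow> norm (\<Psi> z - \<Psi> w) \<le> L2 * norm (z - w)"
    using holo_on_locally_lipschitz[OF V _ h\<Psi>] by metis
  define D where "D = \<Phi> ` (\<Omega> \<inter> U)"
  have Deq: "D = \<Phi> ` U \<inter> \<Psi> -` (\<Omega> \<inter> U)" using \<Psi> by (auto simp: D_def)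
  have Dop: "open D"
    unfolding Deq using continuous_open_preimage[OF holo_on_imp_continuous_on[OF h\<Psi>] V] op U by blast
  have notD: "\<Phi> y \<notin> D" if "y \<in> U" "y \<notin> \<Omega>" for y
  proof
    assume "\<Phi> y \<in> D"
    then obtain x where "x \<in> \<Omega>" "x \<in> U" "\<Phi> y = \<Phi> x" by (auto simp: D_def)
    then show False using inj_onD[OF inj, of y x] that by simp
  qed
  \<comment> \<open>The first bound keeps q, which lies within 2 * R of p, in the Lipschitz ball of
    \<Phi>; the second puts the image of the patch in half the Lipschitz ball of \<Psi>.\<close>
  define R where "R = min (r1 / 2) (r2 / (2 * L1))"
  have R: "R > 0" "2 * R \<le> r1" "L1 * R \<le> r2 / 2"
    using r1 r2 by (auto simp: R_def min_def field_simps)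
  \<comment> \<open>The summands serve, in order: the upper bound at x, the boundary comparison for
    small \<open>Re (h z)\<close>, the bound of \<open>Re (h z)\<close> by C, and the boundary
    comparison for large \<open>Re (h z)\<close>.\<close>
  define C where "C = L1 + L2 + 3 * L1 * R + 2 * R / r2"
  have C: "C > 0" "L1 \<le> C" "L2 \<le> C" "3 * L1 * R \<le> C" "2 * R / r2 \<le> C"
    using r1 r2 R by (auto simp: C_def add_pos_pos add_nonneg_nonneg)
  have frn: "frontier \<Omega> \<noteq> {}" using p by blast
  have main: "\<exists>h h'. support_fn \<Omega> p R C h h' \<and> Re (h x) \<le> C * bdist \<Omega> x"
    if x: "x \<in> \<Omega>" "x \<in> ball p R" for x
  proof -
    obtain q where q: "q \<in> frontier \<Omega>" "bdist \<Omega> x = dist x q"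
      using infdist_attains_inf[of "frontier \<Omega>" x] frn unfolding bdist_def by auto
    have "bdist \<Omega> x \<le> dist x p" unfolding bdist_def by (rule infdist_le[OF p])
    then have qR: "dist p q < 2 * R" using q x dist_triangle[of p q x] by (simp add: dist_commute)
    then have qU: "q \<in> U" "q \<in> ball p r1" using r1 R by auto
    have "q \<notin> \<Omega>" using q op by (simp add: frontier_def interior_open)
    then have qD: "\<Phi> q \<notin> D" using notD qU by blast
    have xU: "x \<in> U" using x R r1 by auto
    have "D \<noteq> {}" using x xU by (auto simp: D_def)
    then obtain a b where a: "a \<noteq> 0" "a \<bullet> \<Phi> q \<le> b" "\<And>w. w \<in> D \<Longrightarrow> b \<le> a \<bullet> w"
      using separating_hyperplane_sets[of "{\<Phi> q}" D] conv qD unfolding D_def by auto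
    \<comment> \<open>Separation is only weak, but \<open>D\<close> is open: its points can be
      pushed a little against a and stay on the right side, which makes the inequality strict on
      \<open>D\<close>.\<close>
    have strict: "a \<bullet> \<Phi> q < a \<bullet> w" if w: "w \<in> D" for w
    proof -
      obtain \<epsilon> where \<epsilon>: "\<epsilon> > 0" "cball w \<epsilon> \<subseteq> D" using Dop w open_contains_cball by blast
      have "w - (\<epsilon> / norm a) *\<^sub>R a \<in> D" using \<epsilon> a by (intro subsetD[OF \<epsilon>(2)]) (simp add: dist_norm)
      then have "b \<le> a \<bullet> w - \<epsilon> / norm a * (a \<bullet> a)" using a(3) by (fastforce simp: inner_diff_right)
      moreover have "\<epsilon> / norm a * (a \<bullet> a) > 0" using \<epsilon> a by simp
      ultimately show ?thesis using a by linarith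
    qed
    define e where "e = a /\<^sub>R norm a"
    have e: "norm e = 1" using a by (simp add: e_def)
    have epos: "0 < e \<bullet> (w - \<Phi> q)" if "w \<in> D" for w
      using strict[OF that] a by (simp add: e_def inner_diff_right)
    \<comment> \<open>The complex linear functional with real part e \<bullet> v; through it a real
      hyperplane yields a holomorphic function.\<close>
    define T where "T = (\<lambda>v. \<Sum>i\<in>UNIV. cnj (e $ i) * v $ i)"
    have Tlin: "T (u + v) = T u + T v" "T (c *s v) = c * T v" for u v c
      by (simp_all add: T_def sum.distrib sum_distrib_left algebra_simps)
    have Tbl: "bounded_linear T" unfolding T_def
      by (intro bounded_linear_sum bounded_linear_const_mult bounded_linear_vec_nth)
    have ReT: "Re (T v) = e \<bullet> v" for v unfolding T_def by (rule Re_hermitian_sum)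
    have ReTle: "Re (T v) \<le> norm v" for v using norm_cauchy_schwarz[of e v] e ReT by simp
    define h where "h = (\<lambda>z. T (\<Phi> z - \<Phi> q))"
    have "\<forall>z\<in>U. \<exists>P. (\<Phi> has_derivative P) (at z) \<and> complex_linear P" using h\<Phi> unfolding holo_on_def .
    then obtain P where P: "\<And>z. z \<in> U \<Longrightarrow> (\<Phi> has_derivative P z) (at z) \<and> complex_linear (P z)" by metis
    define h' where "h' = (\<lambda>z v. T (P z v))"
    have "support_fn \<Omega> p R C h h'"
      unfolding support_fn_def
    proof (intro ballI conjI allI)
      fix z assume "z \<in> \<Omega> \<inter> ball p R"
      then have z: "z \<in> \<Omega>" "dist p z < R" by auto
      have zb: "z \<in> ball p r1" using z R by auto
      then have zU: "z \<in> U" using r1 by auto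
      show "(h has_derivative h' z) (at z)"
        unfolding h_def h'_def using P[OF zU]
        by (intro bounded_linear.has_derivative[OF Tbl]) (auto intro!: derivative_eq_intros)
      show "h' z (c *s v) = c * h' z v" for c v
        using P[OF zU] by (simp add: h'_def complex_linear_def Tlin)
      have "\<Phi> z \<in> D" using z zU by (auto simp: D_def)
      then show s: "0 < Re (h z)" using epos by (simp add: h_def ReT)
      have "Re (h z) \<le> L1 * norm (z - q)"
        using ReTle[of "\<Phi> z - \<Phi> q"] lip1[OF zb qU(2)] by (simp add: h_def)
      also have "\<dots> \<le> L1 * (3 * R)"
        using r1 z qR dist_triangle[of z q p] by (intro mult_left_mono) (auto simp: dist_norm norm_minus_commute)
      finally show "Re (h z) \<le> C" using C by simp
      show "bdist \<Omega> z \<le> C * Re (h z)"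
      proof (cases "Re (h z) < r2 / 2")
        case True
        \<comment> \<open>The orthogonal projection of \<Phi> z to the hyperplane through \<Phi> q,
          hence a point outside \<open>D\<close>. The case assumption keeps it in the ball where
          \<Psi> is Lipschitz.\<close>
        define w where "w = \<Phi> z - Re (h z) *\<^sub>R e"
        have "norm (\<Phi> p - \<Phi> z) \<le> L1 * norm (p - z)" using lip1[of p z] r1 zb by simp
        also have "\<dots> \<le> L1 * R" using z r1 by (intro mult_left_mono) (auto simp: dist_norm)
        finally have n: "norm (\<Phi> p - \<Phi> z) \<le> r2 / 2" using R by simp
        have nw: "norm (w - \<Phi> z) = Re (h z)" using s e by (simp add: w_def)
        have wb: "w \<in> ball (\<Phi> p) r2"
          using n nw True norm_triangle_ineq[of "\<Phi> p - \<Phi> z" "\<Phi> z - w"] by (simp add: dist_norm norm_minus_commute)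
        then obtain y where y: "y \<in> U" "w = \<Phi> y" using r2 by blast
        have "e \<bullet> (w - \<Phi> q) = 0"
          using e by (simp add: w_def h_def ReT inner_diff_right dot_square_norm)
        then have "y \<notin> \<Omega>" using epos[of w] y unfolding D_def by force
        then have "bdist \<Omega> z \<le> dist z y" using bdist_le_dist z by blast
        also have "\<dots> = norm (\<Psi> w - \<Psi> (\<Phi> z))" using y \<Psi> zU by (simp add: dist_norm norm_minus_commute)
        also have "\<dots> \<le> L2 * norm (w - \<Phi> z)"
          using lip2[OF wb, of "\<Phi> z"] n r2 by (simp add: dist_norm)
        also have "\<dots> \<le> C * Re (h z)" using nw C s by (simp add: mult_right_mono)
        finally show ?thesis .
      next
        case False
        have "bdist \<Omega> z \<le> dist z p" unfolding bdist_def by (rule infdist_le[OF p])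
        also have "\<dots> \<le> R" using z by (simp add: dist_commute)
        also have "\<dots> \<le> 2 * R / r2 * Re (h z)" using False r2 R by (simp add: field_simps)
        also have "\<dots> \<le> C * Re (h z)" using C s by (intro mult_right_mono) auto
        finally show ?thesis .
      qed
    qed
    moreover have "Re (h x) \<le> C * bdist \<Omega> x"
    proof -
      have "Re (h x) \<le> L1 * norm (x - q)"
        using ReTle[of "\<Phi> x - \<Phi> q"] lip1[OF _ qU(2), of x] x R by (simp add: h_def)
      also have "\<dots> \<le> C * norm (x - q)" using C by (intro mult_right_mono) auto
      finally show ?thesis using q by (simp add: dist_norm)
    qed
    ultimately show ?thesis by blast
  qed
  show thesis by (rule that[OF R(1) C(1) main])
qed

section \<open>Confinement of holomorphic discs\<close>

lemma holo_disc_increment: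
  fixes f :: "complex \<Rightarrow> complex ^ 'n"
  assumes f: "holo_disc \<Omega> f" and seg: "closed_segment u v \<subseteq> ball 0 1"
    and m: "\<And>\<zeta>. \<zeta> \<in> closed_segment u v \<Longrightarrow> norm (cderiv f \<zeta>) \<le> m"
  shows "norm (f v - f u) \<le> m * cmod (v - u)"
proof (rule differentiable_bound[OF convex_closed_segment])
  fix \<zeta> assume \<zeta>: "\<zeta> \<in> closed_segment u v"
  then have "cmod \<zeta> < 1" using seg by auto
  from holo_disc_has_derivative[OF f this]
  show "(f has_derivative (\<lambda>h. h *s cderiv f \<zeta>)) (at \<zeta> within closed_segment u v)"
    by (rule has_derivative_at_withinI)
  have "0 \<le> m" using m[OF \<zeta>] norm_ge_zero order_trans by blast
  then show "onorm (\<lambda>h. h *s cderiv f \<zeta>) \<le> m"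
    using m[OF \<zeta>] by (intro onorm_bound) (auto simp: norm_cvec_scale mult.commute[of m] mult_left_mono)
qed auto

lemma holo_disc_compose_support:
  assumes f: "holo_disc \<Omega> f" and h: "support_fn \<Omega> p R C h h'"
    and r: "r \<le> 1" "\<And>\<zeta>. cmod \<zeta> < r \<Longrightarrow> f \<zeta> \<in> ball p R"
  shows "(\<lambda>\<zeta>. h (f \<zeta>)) holomorphic_on ball 0 r"
    and "cmod \<zeta> < r \<Longrightarrow> 0 < Re (h (f \<zeta>))"
    and "0 < r \<Longrightarrow> deriv (\<lambda>\<zeta>. h (f \<zeta>)) 0 = h' (f 0) (cderiv f 0)"
proof -
  have mem: "f \<zeta> \<in> \<Omega> \<inter> ball p R" if "cmod \<zeta> < r" for \<zeta>
    using that r f by (fastforce simp: holo_disc_def)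
  have d: "((\<lambda>\<zeta>. h (f \<zeta>)) has_field_derivative h' (f \<zeta>) (cderiv f \<zeta>)) (at \<zeta>)" if "cmod \<zeta> < r" for \<zeta>
  proof (rule complex_chain_rule)
    show "(f has_derivative (\<lambda>k. k *s cderiv f \<zeta>)) (at \<zeta>)"
      using that r by (intro holo_disc_has_derivative[OF f]) auto
  qed (use h mem[OF that] in \<open>auto simp: support_fn_def\<close>)
  show "(\<lambda>\<zeta>. h (f \<zeta>)) holomorphic_on ball 0 r"
    unfolding holomorphic_on_def field_differentiable_def
    using d has_field_derivative_at_within by (metis mem_ball_0)
  show "0 < Re (h (f \<zeta>))" if "cmod \<zeta> < r" using h mem[OF that] by (auto simp: support_fn_def)
  show "deriv (\<lambda>\<zeta>. h (f \<zeta>)) 0 = h' (f 0) (cderiv f 0)" if "0 < r"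
    using d[of 0] that by (intro DERIV_imp_deriv) auto
qed

text \<open>Vacuous once B * \<open>bdist \<Omega> z\<close> reaches 1. The content is near the
  boundary, where the collar omitted from the unit disc has width proportional to the boundary
  distance.\<close>

definition discs_confined :: "(complex ^ 'n) set \<Rightarrow> (complex ^ 'n) \<Rightarrow> real \<Rightarrow> real \<Rightarrow> bool" where
  "discs_confined \<Omega> p R B \<longleftrightarrow> (\<forall>z f \<zeta>. z \<in> \<Omega> \<longrightarrow> z \<in> ball p (R / 2) \<longrightarrow> holo_disc \<Omega> f \<longrightarrow> f 0 = z \<longrightarrow>
     cmod \<zeta> < 1 - B * bdist \<Omega> z \<longrightarrow> f \<zeta> \<in> ball p R)"

text \<open>The integral condition survives only as \<open>W_dyadic\<close>. There \<epsilon>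
  depends on \<eta> but not on a: climbing through dyadic scales from any height to the fixed height
  \<epsilon> has total weight at most \<eta>.\<close>

locale log_weighted_domain =
  fixes \<Omega> :: "(complex ^ 'n) set" and c0 :: real and W :: "real \<Rightarrow> real"
  assumes op: "open \<Omega>" and bd: "bounded \<Omega>" and c0: "0 < c0"
    and kob_lower: "\<And>x v. x \<in> \<Omega> \<Longrightarrow> c0 * norm v / W (bdist \<Omega> x) \<le> kob_royden \<Omega> x v"
    and W_pos: "\<And>t. 0 < t \<Longrightarrow> 0 < W t"
    and W_mono: "\<And>s t. 0 < s \<Longrightarrow> s \<le> t \<Longrightarrow> W s \<le> W t"
    and W_dyadic: "\<And>\<eta>. 0 < \<eta> \<Longrightarrow> \<exists>\<epsilon>>0. \<forall>a>0. \<exists>K::nat. (\<Sum>i<K. W (a * 2 ^ i)) \<le> \<eta> \<and> \<epsilon> < a * 2 ^ K"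
begin

text \<open>The disc itself bounds the metric of its velocity from above, and
  \<open>kob_lower\<close> bounds it from below. Monotonicity of \<open>W\<close> admits any upper
  estimate t of the boundary distance.\<close>

lemma disc_derivative_bound:
  assumes f: "holo_disc \<Omega> f" and \<zeta>: "cmod \<zeta> < 1" and t: "bdist \<Omega> (f \<zeta>) \<le> t" and s: "0 < s" "s \<le> 1 - cmod \<zeta>"
  shows "norm (cderiv f \<zeta>) \<le> W t / (c0 * s)"
proof -
  have m: "f \<zeta> \<in> \<Omega>" using f \<zeta> by (force simp: holo_disc_def)
  have b: "0 < bdist \<Omega> (f \<zeta>)" by (rule bdist_pos[OF op bd m])
  have "c0 * norm (cderiv f \<zeta>) / W (bdist \<Omega> (f \<zeta>)) \<le> 1 / (1 - cmod \<zeta>)"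
    using kob_lower[OF m] kob_royden_disc_le[OF f \<zeta>] order_trans by blast
  also have "\<dots> \<le> 1 / s" using s by (intro divide_left_mono) auto
  finally have "norm (cderiv f \<zeta>) \<le> W (bdist \<Omega> (f \<zeta>)) / (c0 * s)"
    using W_pos[OF b] c0 s by (simp add: field_simps)
  also have "\<dots> \<le> W t / (c0 * s)" using W_mono[OF b t] c0 s by (intro divide_right_mono) auto
  finally show ?thesis .
qed

text \<open>On the smallest circle where a disc leaves the half-size ball, the shell at relative distance
  \<open>2\<^sup>-\<^sup>k\<close> from it contributes at most \<open>W (a 2\<^sup>k) / c0\<close> to the displacement, by
  the half-plane Schwarz lemma and the lower bound on the metric.\<close>

lemma discs_stay_near:
  assumes R: "0 < R" and C: "0 < C"
    and supp: "\<And>x. x \<in> \<Omega> \<Longrightarrow> x \<in> ball p R \<Longrightarrow> \<exists>h h'. support_fn \<Omega> p R C h h' \<and> Re (h x) \<le> C * bdist \<Omega> x"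
  obtains B where "0 < B"
    "discs_confined \<Omega> p R B"
proof -
  obtain M where M: "M > 0" "\<And>x. x \<in> \<Omega> \<Longrightarrow> bdist \<Omega> x \<le> M" using bounded_bdist[OF bd] by (metis (no_types, lifting))
  have "0 < c0 * R / 8" using c0 R by simp
  from W_dyadic[OF this] obtain \<epsilon> where \<epsilon>: "\<epsilon> > 0"
    "\<And>a. a > 0 \<Longrightarrow> \<exists>K::nat. (\<Sum>i<K. W (a * 2 ^ i)) \<le> c0 * R / 8 \<and> \<epsilon> < a * 2 ^ K" by blast
  \<comment> \<open>Makes the last radial piece contribute exactly R / 8: its length is at most 4 *
    C^2 * \<delta> / \<epsilon> and the velocity on it at most \<open>W M\<close> / (c0 * B *
    \<delta>), so \<delta> cancels.\<close>
  define B where "B = 32 * C\<^sup>2 * W M / (\<epsilon> * c0 * R)"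
  have B: "B > 0" using C W_pos[OF M(1)] \<epsilon> c0 R by (simp add: B_def)
  show thesis
  proof (rule that[OF B], unfold discs_confined_def, intro allI impI, rule ccontr)
    fix z f \<zeta>1
    assume z: "z \<in> \<Omega>" "z \<in> ball p (R / 2)" and f: "holo_disc \<Omega> f" "f 0 = z"
      and \<zeta>1: "cmod \<zeta>1 < 1 - B * bdist \<Omega> z" and out: "f \<zeta>1 \<notin> ball p R"
    define \<delta> where "\<delta> = bdist \<Omega> z"
    have \<delta>: "\<delta> > 0" unfolding \<delta>_def by (rule bdist_pos[OF op bd z(1)])
    have \<zeta>11: "cmod \<zeta>1 < 1" using \<zeta>1 B \<delta> unfolding \<delta>_def by (smt (verit) mult_pos_pos)
    have cont: "continuous_on (ball 0 1) f"
    proof (intro continuous_at_imp_continuous_on ballI)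
      fix \<zeta> :: complex assume "\<zeta> \<in> ball 0 1"
      then have "cmod \<zeta> < 1" by simp
      then show "isCont f \<zeta>" by (rule has_derivative_continuous[OF holo_disc_has_derivative[OF f(1)]])
    qed
    \<comment> \<open>A point of \<open>E\<close> of least modulus is a first exit. As z lies in the
      half-size ball, the disc stays in \<open>ball p R\<close> on smaller radii, where
      \<open>h\<close> may be applied.\<close>
    define E where "E = {\<zeta> \<in> cball 0 (cmod \<zeta>1). R / 2 \<le> norm (f \<zeta> - z)}"
    have "continuous_on (cball 0 (cmod \<zeta>1)) (\<lambda>\<zeta>. norm (f \<zeta> - z))"
      using \<zeta>11 by (intro continuous_intros continuous_on_subset[OF cont]) auto
    then have "closed (cball 0 (cmod \<zeta>1) \<inter> (\<lambda>\<zeta>. norm (f \<zeta> - z)) -` {R / 2..})"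
      by (intro continuous_closed_preimage) auto
    moreover have "E = cball 0 (cmod \<zeta>1) \<inter> (\<lambda>\<zeta>. norm (f \<zeta> - z)) -` {R / 2..}"
      unfolding E_def by auto
    ultimately have "compact E"
      by (metis bounded_Int bounded_cball compact_eq_bounded_closed)
    moreover have "\<zeta>1 \<in> E"
      using out z norm_triangle_ineq[of "f \<zeta>1 - z" "z - p"] by (simp add: E_def dist_norm norm_minus_commute)
    ultimately obtain \<zeta>0 where \<zeta>0: "\<zeta>0 \<in> E" "\<And>\<zeta>. \<zeta> \<in> E \<Longrightarrow> cmod \<zeta>0 \<le> cmod \<zeta>"
      using continuous_attains_inf[of E cmod] continuous_on_norm_id by blast
    define s where "s = cmod \<zeta>0"
    have far: "R / 2 \<le> norm (f \<zeta>0 - f 0)" using \<zeta>0 f by (simp add: E_def)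
    have s0: "s > 0" using far R by (auto simp: s_def)
    have s1: "s < 1 - B * \<delta>" using \<zeta>0 \<zeta>1 by (simp add: E_def s_def \<delta>_def)
    have sl1: "s < 1" using \<zeta>0 \<zeta>11 by (simp add: E_def s_def)
    have inb: "f \<zeta> \<in> ball p R" if "cmod \<zeta> < s" for \<zeta>
    proof -
      have "cmod \<zeta> \<le> cmod \<zeta>1" using that \<zeta>0 by (simp add: s_def E_def)
      moreover have "\<zeta> \<notin> E" using that \<zeta>0(2)[of \<zeta>] by (auto simp: s_def)
      ultimately have "norm (f \<zeta> - z) < R / 2" by (simp add: E_def)
      then show ?thesis using z norm_triangle_ineq[of "f \<zeta> - z" "z - p"] by (simp add: dist_norm norm_minus_commute)
    qed
    have "z \<in> ball p R" using z R by auto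
    then obtain h h' where h: "support_fn \<Omega> p R C h h'" and hz: "Re (h z) \<le> C * \<delta>"
      using supp[OF z(1)] \<delta>_def by blast
    note comp = holo_disc_compose_support[OF f(1) h less_imp_le[OF sl1] inb]
    \<comment> \<open>One factor C comes from \<open>Re (h z)\<close> at the centre, the other from
      the boundary comparison at \<open>f \<zeta>\<close>. Schwarz is applied on radius s, since
      beyond it the disc may have left the patch.\<close>
    have growth: "bdist \<Omega> (f \<zeta>) \<le> 2 * C\<^sup>2 * \<delta> * (s / (s - cmod \<zeta>))" if \<zeta>: "cmod \<zeta> < s" for \<zeta>
    proof -
      have "f \<zeta> \<in> \<Omega> \<inter> ball p R" using inb[OF \<zeta>] f \<zeta> sl1 by (force simp: holo_disc_def)
      then have "bdist \<Omega> (f \<zeta>) \<le> C * Re (h (f \<zeta>))" using h by (auto simp: support_fn_def)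
      also have "Re (h (f \<zeta>)) \<le> Re (h (f 0)) * ((s + cmod \<zeta>) / (s - cmod \<zeta>))"
        using comp by (intro half_plane_Schwarz(1)[OF _ s0]) (use \<zeta> in auto)
      also have "\<dots> \<le> (C * \<delta>) * ((2 * s) / (s - cmod \<zeta>))"
        using hz f \<zeta> C \<delta> s0 by (intro mult_mono divide_right_mono divide_nonneg_nonneg add_nonneg_nonneg) auto
      finally show ?thesis using C by (simp add: power2_eq_square field_simps)
    qed
    \<comment> \<open>The growth bound at distance s / 2 ^ (k + 1) from the circle of radius s
      equals a * 2 ^ k.\<close>
    define a where "a = 4 * C\<^sup>2 * \<delta>"
    have a: "a > 0" using C \<delta> by (simp add: a_def)
    obtain K :: nat where K: "(\<Sum>i<K. W (a * 2 ^ i)) \<le> c0 * R / 8" "\<epsilon> < a * 2 ^ K" using \<epsilon>(2)[OF a] by blast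
    define t where "t = (\<lambda>k::nat. 1 - (1 / 2) ^ k :: real)"
    have tt: "0 \<le> t k" "t k < 1" for k by (auto simp: t_def power_le_one)
    have seg: "\<exists>\<tau>\<ge>u. \<tau> \<le> v \<and> \<zeta> = of_real \<tau> * \<zeta>0 \<and> cmod \<zeta> = \<tau> * s"
      if "\<zeta> \<in> closed_segment (of_real u * \<zeta>0) (of_real v * \<zeta>0)" "0 \<le> u" "u \<le> v" for u v \<zeta>
    proof -
      from that(1) obtain x where x: "0 \<le> x" "x \<le> 1" "\<zeta> = (1 - x) *\<^sub>R (of_real u * \<zeta>0) + x *\<^sub>R (of_real v * \<zeta>0)"
        unfolding in_segment by auto
      define \<tau> where "\<tau> = u + x * (v - u)"
      have "\<zeta> = of_real \<tau> * \<zeta>0" by (simp add: x(3) \<tau>_def scaleR_conv_of_real algebra_simps)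
      moreover have "u \<le> \<tau>" "\<tau> \<le> v"
        using x that mult_left_le_one_le[of "v - u" x] by (auto simp: \<tau>_def)
      ultimately show ?thesis using that by (intro exI[of _ \<tau>]) (auto simp: norm_mult s_def)
    qed
    have shell: "norm (f (of_real (t (Suc k)) * \<zeta>0) - f (of_real (t k) * \<zeta>0)) \<le> W (a * 2 ^ k) / c0" for k
    proof -
      let ?q = "s * (1 / 2) ^ Suc k"
      have q: "0 < ?q" using s0 by simp
      have tle: "t k \<le> t (Suc k)" by (simp add: t_def)
      have bnd: "cmod \<zeta> < s \<and> ?q \<le> s - cmod \<zeta>"
        if "\<zeta> \<in> closed_segment (of_real (t k) * \<zeta>0) (of_real (t (Suc k)) * \<zeta>0)" for \<zeta>
      proof -
        from seg[OF that tt(1) tle] obtain \<tau> where "\<tau> \<le> t (Suc k)" "cmod \<zeta> = \<tau> * s" by blast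
        then have "s - cmod \<zeta> = s * (1 - \<tau>)" "(1 / 2) ^ Suc k \<le> 1 - \<tau>" by (auto simp: t_def algebra_simps)
        then have "?q \<le> s - cmod \<zeta>" using s0 by (metis mult_left_mono less_imp_le)
        then show ?thesis using q by linarith
      qed
      have "norm (f (of_real (t (Suc k)) * \<zeta>0) - f (of_real (t k) * \<zeta>0))
          \<le> W (a * 2 ^ k) / (c0 * ?q) * cmod (of_real (t (Suc k)) * \<zeta>0 - of_real (t k) * \<zeta>0)"
      proof (rule holo_disc_increment[OF f(1)])
        show "closed_segment (of_real (t k) * \<zeta>0) (of_real (t (Suc k)) * \<zeta>0) \<subseteq> ball 0 1"
          using bnd sl1 by fastforce
        fix \<zeta> assume "\<zeta> \<in> closed_segment (of_real (t k) * \<zeta>0) (of_real (t (Suc k)) * \<zeta>0)"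
        note b = bnd[OF this]
        have "2 * C\<^sup>2 * \<delta> * (s / (s - cmod \<zeta>)) \<le> 2 * C\<^sup>2 * \<delta> * (s / ?q)"
          using b q s0 \<delta> by (intro mult_left_mono divide_left_mono) auto
        also have "\<dots> = a * 2 ^ k" using s0 by (simp add: a_def power_one_over field_simps)
        finally have "bdist \<Omega> (f \<zeta>) \<le> a * 2 ^ k" using growth b by force
        then show "norm (cderiv f \<zeta>) \<le> W (a * 2 ^ k) / (c0 * ?q)"
          using b q sl1 by (intro disc_derivative_bound[OF f(1)]) auto
      qed
      also have "of_real (t (Suc k)) * \<zeta>0 - of_real (t k) * \<zeta>0 = of_real ((1 / 2) ^ Suc k) * \<zeta>0"
        by (simp add: t_def algebra_simps)
      also have "cmod (of_real ((1 / 2) ^ Suc k) * \<zeta>0) = ?q" by (simp only: norm_mult norm_of_real s_def) simp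
      also have "W (a * 2 ^ k) / (c0 * ?q) * ?q = W (a * 2 ^ k) / c0" using s0 by simp
      finally show ?thesis .
    qed
    have t0: "t 0 = 0" by (simp add: t_def)
    have "norm (f (of_real (t K) * \<zeta>0) - f 0) \<le> (\<Sum>k<K. norm (f (of_real (t (Suc k)) * \<zeta>0) - f (of_real (t k) * \<zeta>0)))"
      using sum_lessThan_telescope[of "\<lambda>k. f (of_real (t k) * \<zeta>0)" K]
        norm_sum[of "\<lambda>k. f (of_real (t (Suc k)) * \<zeta>0) - f (of_real (t k) * \<zeta>0)" "{..<K}"] t0 by simp
    also have "\<dots> \<le> (\<Sum>k<K. W (a * 2 ^ k) / c0)" by (intro sum_mono shell)
    also have "\<dots> \<le> (c0 * R / 8) / c0" unfolding sum_divide_distrib[symmetric] using K c0 by (intro divide_right_mono) auto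
    also have "\<dots> = R / 8" using c0 by simp
    finally have part1: "norm (f (of_real (t K) * \<zeta>0) - f 0) \<le> R / 8" .
    \<comment> \<open>Near the circle of radius s the growth bound degenerates. The boundary
      distance is bounded by M instead, and the circle stays farther than B * \<delta> from the unit
      circle.\<close>
    have "norm (f (of_real 1 * \<zeta>0) - f (of_real (t K) * \<zeta>0)) \<le> W M / (c0 * (B * \<delta>)) * cmod (of_real 1 * \<zeta>0 - of_real (t K) * \<zeta>0)"
    proof (rule holo_disc_increment[OF f(1)])
      have bnd: "cmod \<zeta> \<le> s" if "\<zeta> \<in> closed_segment (of_real (t K) * \<zeta>0) (of_real 1 * \<zeta>0)" for \<zeta>
        using seg[OF that tt(1)] tt(2)[of K] s0 by (force simp: mult_le_cancel_right1)
      then show "closed_segment (of_real (t K) * \<zeta>0) (of_real 1 * \<zeta>0) \<subseteq> ball 0 1" using sl1 by force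
      fix \<zeta> assume "\<zeta> \<in> closed_segment (of_real (t K) * \<zeta>0) (of_real 1 * \<zeta>0)"
      note b = bnd[OF this]
      then have "f \<zeta> \<in> \<Omega>" using f sl1 by (force simp: holo_disc_def)
      then show "norm (cderiv f \<zeta>) \<le> W M / (c0 * (B * \<delta>))"
        using b s1 B \<delta> sl1 M by (intro disc_derivative_bound[OF f(1)]) auto
    qed
    also have "of_real 1 * \<zeta>0 - of_real (t K) * \<zeta>0 = of_real ((1 / 2) ^ K) * \<zeta>0" by (simp add: t_def algebra_simps)
    also have "cmod (of_real ((1 / 2) ^ K) * \<zeta>0) = (1 / 2) ^ K * s" by (simp only: norm_mult norm_of_real s_def) simp
    also have "W M / (c0 * (B * \<delta>)) * ((1 / 2) ^ K * s) \<le> W M / (c0 * (B * \<delta>)) * (a / \<epsilon>)"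
    proof (rule mult_left_mono)
      have "(1 / 2) ^ K * s \<le> (1 / 2) ^ K" using sl1 s0 by (simp add: mult_le_cancel_left1)
      also have "\<dots> \<le> a / \<epsilon>" using K \<epsilon> by (simp add: power_one_over field_simps)
      finally show "(1 / 2) ^ K * s \<le> a / \<epsilon>" .
      show "0 \<le> W M / (c0 * (B * \<delta>))" using W_pos[OF M(1)] c0 B \<delta> by simp
    qed
    also have "\<dots> = R / 8"
      using W_pos[OF M(1)] c0 \<delta> \<epsilon> R C by (simp add: B_def a_def field_simps)
    finally have part2: "norm (f \<zeta>0 - f (of_real (t K) * \<zeta>0)) \<le> R / 8" by simp
    have "norm (f \<zeta>0 - f 0) \<le> R / 8 + R / 8"
      using norm_triangle_mono[OF part2 part1] by simp
    then show False using far R by simp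
  qed
qed

text \<open>Schwarz on radius 1 - x with x = B * \<open>bdist \<Omega> z\<close> costs 1 / (1 - x),
  at most 1 + 2 * x when x \<le> 1/2. Estimating x by B * C * \<open>Re (h z)\<close> expresses the
  loss through \<open>h\<close> alone, which makes the bound integrable along paths.\<close>

lemma kob_royden_ge_support:
  assumes h: "support_fn \<Omega> p R C h h'" and z: "z \<in> \<Omega>" "z \<in> ball p (R / 2)" and C: "0 < C" and B: "0 < B"
    and near: "discs_confined \<Omega> p R B"
    and small: "B * bdist \<Omega> z \<le> 1 / 2"
  shows "cmod (h' z v) / (2 * Re (h z) * (1 + 2 * B * C * Re (h z))) \<le> kob_royden \<Omega> z v"
proof (rule kob_royden_ge[OF op z(1)])
  fix f \<alpha> assume f: "holo_disc \<Omega> f" "f 0 = z" "\<alpha> *s cderiv f 0 = v"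
  define u where "u = Re (h z)"
  define x where "x = B * bdist \<Omega> z"
  have R: "R > 0" using z(2) by (smt (verit) dist_not_less_zero half_gt_zero_iff mem_ball)
  have zR: "z \<in> \<Omega> \<inter> ball p R" using z R by auto
  then have u: "u > 0" and du: "bdist \<Omega> z \<le> C * u" using h by (auto simp: support_fn_def u_def)
  have x: "0 \<le> x" "x \<le> 1 / 2" using B small by (auto simp: x_def bdist_nonneg)
  note comp = holo_disc_compose_support[OF f(1) h, of "1 - x"]
  have r: "0 < 1 - x" using x by simp
  have inb: "f \<zeta> \<in> ball p R" if "cmod \<zeta> < 1 - x" for \<zeta> using near z f that by (auto simp: x_def discs_confined_def)
  have "cmod (deriv (\<lambda>\<zeta>. h (f \<zeta>)) 0) \<le> 2 * Re (h (f 0)) / (1 - x)"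
    using comp x inb by (intro half_plane_Schwarz(2)[OF _ r]) auto
  then have *: "cmod (h' z (cderiv f 0)) \<le> 2 * u / (1 - x)"
    using comp(3) inb x r f by (simp add: u_def)
  have "h' z v = \<alpha> * h' z (cderiv f 0)" using h zR f(3) by (auto simp: support_fn_def)
  then have "cmod (h' z v) \<le> cmod \<alpha> * (2 * u / (1 - x))" using mult_left_mono[OF * norm_ge_zero[of \<alpha>]] by (simp add: norm_mult)
  then have le: "cmod (h' z v) * (1 - x) \<le> cmod \<alpha> * (2 * u)" using r by (simp add: field_simps)
  have xu: "x \<le> B * C * u" using du B by (simp add: x_def mult.assoc)
  have "1 \<le> (1 - x) * (1 + 2 * x)" using mult_left_mono[of x "1/2" x] x by (simp add: algebra_simps)
  also have "\<dots> \<le> (1 - x) * (1 + 2 * B * C * u)" using xu r by (intro mult_left_mono) auto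
  finally have "cmod (h' z v) * 1 \<le> cmod (h' z v) * ((1 - x) * (1 + 2 * B * C * u))" by (rule mult_left_mono) simp
  also have "\<dots> \<le> cmod \<alpha> * (2 * u) * (1 + 2 * B * C * u)"
    unfolding mult.assoc[symmetric] using le B C u by (intro mult_right_mono) (auto simp: algebra_simps)
  finally have "cmod (h' z v) \<le> cmod \<alpha> * (2 * u * (1 + 2 * B * C * u))" by (simp add: mult.assoc)
  moreover have "0 < 2 * u * (1 + 2 * B * C * u)" using u B C by (intro mult_pos_pos add_pos_pos) auto
  ultimately show "cmod (h' z v) / (2 * Re (h z) * (1 + 2 * B * C * Re (h z))) \<le> cmod \<alpha>"
    by (simp add: u_def pos_divide_le_eq)
qed

end

section \<open>Length of arcs\<close>

text \<open>Half-open parameter intervals make consecutive arcs disjoint, as superadditivity of the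
  lower integral requires.\<close>

definition kob_arc :: "(complex ^ 'n) set \<Rightarrow> (real \<Rightarrow> complex ^ 'n) \<Rightarrow> real \<Rightarrow> real \<Rightarrow> ennreal" where
  "kob_arc \<Omega> \<gamma> a b = (\<integral>\<^sup>+ t. ennreal (kob_royden \<Omega> (\<gamma> t) (vector_derivative \<gamma> (at t)))
      * indicator {a..<b} t \<partial>lborel)"

lemma kob_arc_add: "a \<le> b \<Longrightarrow> b \<le> c \<Longrightarrow> kob_arc \<Omega> \<gamma> a b + kob_arc \<Omega> \<gamma> b c \<le> kob_arc \<Omega> \<gamma> a c"
  unfolding kob_arc_def by (rule nn_integral_superadditive) auto

lemma kob_arc_le_length: "0 \<le> a \<Longrightarrow> b \<le> 1 \<Longrightarrow> kob_arc \<Omega> \<gamma> a b \<le> kob_length \<Omega> \<gamma>"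
  unfolding kob_arc_def kob_length_def by (intro nn_integral_mono) (auto simp: indicator_def)

lemma kob_arc_ge_increment:
  fixes g :: "real \<Rightarrow> 'a::euclidean_space"
  assumes "a \<le> b" "finite S" "continuous_on {a..b} g"
    and "\<And>t. t \<in> {a<..<b} - S \<Longrightarrow> (g has_vector_derivative g' t) (at t)"
    and "\<And>t. t \<in> {a<..<b} - S \<Longrightarrow> norm (g' t) \<le> kob_royden \<Omega> (\<gamma> t) (vector_derivative \<gamma> (at t))"
  shows "ennreal (norm (g b - g a)) \<le> kob_arc \<Omega> \<gamma> a b"
  unfolding kob_arc_def
  using assms by (intro norm_increment_le_nn_integral) (auto intro: ennreal_leI)

lemma piecewise_C1_vector_derivative:
  assumes "\<gamma> piecewise_C1_differentiable_on {0..1::real}"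
  obtains S where "finite S"
    "\<And>t. t \<in> {0..1} - S \<Longrightarrow> (\<gamma> has_vector_derivative vector_derivative \<gamma> (at t)) (at t)"
  using assms unfolding piecewise_C1_differentiable_on_def C1_differentiable_on_def
  by (metis vector_derivative_at)

lemma first_exit:
  fixes \<phi> :: "real \<Rightarrow> real"
  assumes cont: "continuous_on {s..t} \<phi>" and st: "s \<le> t" and lt: "\<phi> s < c" and ge: "c \<le> \<phi> t"
  obtains s' where "s \<le> s'" "s' \<le> t" "\<phi> s' = c" "\<And>x. s \<le> x \<Longrightarrow> x \<le> s' \<Longrightarrow> \<phi> x \<le> c"
proof -
  define E where "E = {s..t} \<inter> \<phi> -` {c..}"
  have "closed E" unfolding E_def using cont by (intro continuous_closed_preimage) auto
  then have "compact E" by (metis E_def bounded_Int bounded_closed_interval compact_eq_bounded_closed)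
  moreover have "t \<in> E" using st ge by (simp add: E_def)
  ultimately obtain s' where s': "s' \<in> E" "\<And>x. x \<in> E \<Longrightarrow> s' \<le> x"
    using compact_attains_inf[of E] by blast
  have before: "\<phi> x < c" if "s \<le> x" "x < s'" for x
    using s'(2)[of x] s'(1) that by (force simp: E_def)
  have "\<exists>x\<ge>s. x \<le> s' \<and> \<phi> x = c"
    using s' lt by (intro IVT') (auto simp: E_def intro: continuous_on_subset[OF cont])
  then have "\<phi> s' = c" using before by (metis less_le order_less_irrefl)
  then show thesis using s' before by (intro that[of s']) (auto simp: E_def le_less)
qed

context log_weighted_domain
begin

lemma kob_arc_ge_norm:
  assumes \<gamma>: "\<gamma> piecewise_C1_differentiable_on {0..1}" "\<gamma> ` {0..1} \<subseteq> \<Omega>"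
    and ab: "0 \<le> a" "a \<le> b" "b \<le> 1" and m: "\<And>t. t \<in> {a..b} \<Longrightarrow> bdist \<Omega> (\<gamma> t) \<le> m"
  shows "ennreal (c0 * norm (\<gamma> b - \<gamma> a) / W m) \<le> kob_arc \<Omega> \<gamma> a b"
proof -
  obtain S where S: "finite S" "\<And>t. t \<in> {0..1} - S \<Longrightarrow> (\<gamma> has_vector_derivative vector_derivative \<gamma> (at t)) (at t)"
    using piecewise_C1_vector_derivative[OF \<gamma>(1)] by metis
  have pos: "0 < bdist \<Omega> (\<gamma> t)" if "t \<in> {a..b}" for t
    using \<gamma>(2) that ab by (intro bdist_pos[OF op bd]) (auto simp: image_subset_iff)
  have "0 < m" using pos[of a] m[of a] ab by auto
  then have Wm: "0 < W m" by (rule W_pos)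
  have "ennreal (norm ((c0 / W m) *\<^sub>R \<gamma> b - (c0 / W m) *\<^sub>R \<gamma> a)) \<le> kob_arc \<Omega> \<gamma> a b"
  proof (rule kob_arc_ge_increment[OF ab(2) S(1), where g' = "\<lambda>t. (c0 / W m) *\<^sub>R vector_derivative \<gamma> (at t)"])
    show "continuous_on {a..b} (\<lambda>t. (c0 / W m) *\<^sub>R \<gamma> t)"
      using \<gamma>(1) ab by (intro continuous_intros) (auto simp: piecewise_C1_differentiable_on_def intro: continuous_on_subset)
    fix t assume t: "t \<in> {a<..<b} - S"
    then show "((\<lambda>t. (c0 / W m) *\<^sub>R \<gamma> t) has_vector_derivative (c0 / W m) *\<^sub>R vector_derivative \<gamma> (at t)) (at t)"
      using S(2)[of t] ab by (auto intro!: derivative_eq_intros)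
    have tab: "t \<in> {a..b}" using t by auto
    have "norm ((c0 / W m) *\<^sub>R vector_derivative \<gamma> (at t)) = c0 * norm (vector_derivative \<gamma> (at t)) / W m"
      using c0 Wm by simp
    also have "\<dots> \<le> c0 * norm (vector_derivative \<gamma> (at t)) / W (bdist \<Omega> (\<gamma> t))"
      using W_mono[OF pos[OF tab] m[OF tab]] W_pos[OF pos[OF tab]] c0 by (intro divide_left_mono) auto
    also have "\<dots> \<le> kob_royden \<Omega> (\<gamma> t) (vector_derivative \<gamma> (at t))"
      using \<gamma>(2) t ab by (intro kob_lower) auto
    finally show "norm ((c0 / W m) *\<^sub>R vector_derivative \<gamma> (at t)) \<le> kob_royden \<Omega> (\<gamma> t) (vector_derivative \<gamma> (at t))" .
  qed
  moreover have "norm ((c0 / W m) *\<^sub>R \<gamma> b - (c0 / W m) *\<^sub>R \<gamma> a) = c0 * norm (\<gamma> b - \<gamma> a) / W m"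
    using c0 Wm by (simp add: scaleR_diff_right[symmetric])
  ultimately show ?thesis by simp
qed

lemma kob_arc_ge_log:
  assumes h: "support_fn \<Omega> p R C h h'" and C: "0 < C" and B: "0 < B" and R: "0 < R"
    and near: "discs_confined \<Omega> p R B"
    and \<gamma>: "\<gamma> piecewise_C1_differentiable_on {0..1}" "\<gamma> ` {0..1} \<subseteq> \<Omega>"
    and ab: "0 \<le> a" "a \<le> b" "b \<le> 1"
    and mem: "\<And>t. t \<in> {a..b} \<Longrightarrow> \<gamma> t \<in> ball p (R / 2) \<and> B * bdist \<Omega> (\<gamma> t) \<le> 1 / 2"
    and w: "w = (\<lambda>z. Re (h z) / (1 + 2 * B * C * Re (h z)))"
  shows "ennreal \<bar>1/2 * ln (w (\<gamma> b)) - 1/2 * ln (w (\<gamma> a))\<bar> \<le> kob_arc \<Omega> \<gamma> a b"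
proof -
  obtain S where S: "finite S" "\<And>t. t \<in> {0..1} - S \<Longrightarrow> (\<gamma> has_vector_derivative vector_derivative \<gamma> (at t)) (at t)"
    using piecewise_C1_vector_derivative[OF \<gamma>(1)] by metis
  define K where "K = 2 * B * C"
  have K: "K > 0" using B C by (simp add: K_def)
  define u where "u = (\<lambda>t. Re (h (\<gamma> t)))"
  have mem': "\<gamma> t \<in> \<Omega> \<inter> ball p R" if "t \<in> {a..b}" for t
    using mem[OF that] \<gamma>(2) ab that R by (auto simp: image_subset_iff)
  have u: "u t > 0" "1 + K * u t > 0" if "t \<in> {a..b}" for t
    using h mem'[OF that] K by (auto simp: support_fn_def u_def add_pos_pos)
  have hd: "(h has_derivative h' (\<gamma> t)) (at (\<gamma> t))" if "t \<in> {a..b}" for t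
    using h mem'[OF that] by (auto simp: support_fn_def)
  \<comment> \<open>This is (1/2) ln w along the path, split into two logarithms. The derivatives
    combine to u' / (2 * u * (1 + K * u)), the quantity that \<open>kob_royden_ge_support\<close>
    controls.\<close>
  define g where "g = (\<lambda>t. 1/2 * ln (u t) - 1/2 * ln (1 + K * u t))"
  define u' where "u' = (\<lambda>t. Re (h' (\<gamma> t) (vector_derivative \<gamma> (at t))))"
  have contu: "continuous_on {a..b} u"
  proof -
    have "continuous_on (\<gamma> ` {a..b}) h"
      using hd has_derivative_continuous by (intro continuous_at_imp_continuous_on) blast
    moreover have "continuous_on {a..b} \<gamma>"
      using \<gamma>(1) ab by (auto simp: piecewise_C1_differentiable_on_def intro: continuous_on_subset)
    ultimately show ?thesis unfolding u_def by (intro continuous_intros) (auto intro: continuous_on_compose2)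
  qed
  have "ennreal (norm (g b - g a)) \<le> kob_arc \<Omega> \<gamma> a b"
  proof (rule kob_arc_ge_increment[OF ab(2) S(1), where g' = "\<lambda>t. u' t / (2 * u t * (1 + K * u t))"])
    show "continuous_on {a..b} g"
      unfolding g_def using u by (intro continuous_intros contu) (auto simp: less_imp_neq[symmetric])
    fix t assume t: "t \<in> {a<..<b} - S"
    then have tab: "t \<in> {a..b}" and t01: "t \<in> {0..1} - S" using ab by auto
    note ut = u[OF tab]
    have "((\<lambda>t. h (\<gamma> t)) has_derivative (\<lambda>x. h' (\<gamma> t) (x *\<^sub>R vector_derivative \<gamma> (at t)))) (at t)"
      using S(2)[OF t01] by (intro has_derivative_compose[where f = \<gamma> and g = h, OF _ hd[OF tab]]) (simp add: has_vector_derivative_def)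
    then have "(u has_derivative (\<lambda>x. Re (h' (\<gamma> t) (x *\<^sub>R vector_derivative \<gamma> (at t))))) (at t)"
      unfolding u_def by (rule bounded_linear.has_derivative[OF bounded_linear_Re])
    moreover have "(\<lambda>x. Re (h' (\<gamma> t) (x *\<^sub>R vector_derivative \<gamma> (at t)))) = (*) (u' t)"
      using linear_scale[OF has_derivative_linear[OF hd[OF tab]]] by (auto simp: u'_def)
    ultimately have du: "(u has_field_derivative u' t) (at t)" by (simp add: has_field_derivative_def)
    have "((\<lambda>t. 1 + K * u t) has_field_derivative K * u' t) (at t)"
      by (auto intro!: derivative_eq_intros du)
    note dlog = DERIV_chain2[OF DERIV_ln_divide[OF ut(1)] du] DERIV_chain2[OF DERIV_ln_divide[OF ut(2)] this]
    have "(g has_field_derivative 1/2 * (1 / u t * u' t) - 1/2 * (1 / (1 + K * u t) * (K * u' t))) (at t)"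
      unfolding g_def by (intro DERIV_diff DERIV_cmult dlog)
    moreover have "1/2 * (1 / u t * u' t) - 1/2 * (1 / (1 + K * u t) * (K * u' t)) = u' t / (2 * u t * (1 + K * u t))"
      using ut by (simp add: divide_simps) (simp add: algebra_simps)
    ultimately show "(g has_vector_derivative u' t / (2 * u t * (1 + K * u t))) (at t)"
      by (simp add: has_real_derivative_iff_has_vector_derivative)
    have "norm (u' t / (2 * u t * (1 + K * u t))) = \<bar>u' t\<bar> / (2 * u t * (1 + K * u t))"
      using ut by (simp add: abs_mult)
    also have "\<dots> \<le> cmod (h' (\<gamma> t) (vector_derivative \<gamma> (at t))) / (2 * u t * (1 + K * u t))"
      using ut by (intro divide_right_mono) (auto simp: u'_def abs_Re_le_cmod)
    also have "\<dots> \<le> kob_royden \<Omega> (\<gamma> t) (vector_derivative \<gamma> (at t))"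
      unfolding u_def K_def
      using mem[OF tab] mem'[OF tab] by (intro kob_royden_ge_support[OF h _ _ C B near]) auto
    finally show "norm (u' t / (2 * u t * (1 + K * u t))) \<le> kob_royden \<Omega> (\<gamma> t) (vector_derivative \<gamma> (at t))" .
  qed
  moreover have "g t = 1/2 * ln (w (\<gamma> t))" if "t \<in> {a..b}" for t
    using u[OF that] unfolding w g_def by (simp add: u_def K_def ln_div algebra_simps)
  ultimately show ?thesis using ab by simp
qed

end

section \<open>Paths that leave the chart\<close>

lemma ln_le_of_quotient:
  fixes a b c :: real
  assumes "0 < a" "0 < b" "0 < c" "a \<le> c * b"
  shows "ln a - ln b \<le> \<bar>ln c\<bar>"
proof -
  have "ln a \<le> ln (c * b)" using assms by (intro ln_mono) auto
  also have "\<dots> = ln c + ln b" using assms by (simp add: ln_mult)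
  finally show ?thesis by linarith
qed

context log_weighted_domain
begin

text \<open>By induction on j there is a time with arc length at least (j/2) ln 2, \<open>w\<close>
  at most 2 ^ j * d0 and displacement at most \<rho> j. Only upper bounds on \<open>w\<close> are
  carried along, so \<open>w\<close> may fall back between events without harm. The displacement at
  T leaves room for N events.\<close>

lemma kob_arc_crossing:
  assumes h: "support_fn \<Omega> p R C h h'" and C: "0 < C" and B: "0 < B" and R: "0 < R"
    and near: "discs_confined \<Omega> p R B"
    and \<gamma>: "\<gamma> piecewise_C1_differentiable_on {0..1}" "\<gamma> ` {0..1} \<subseteq> \<Omega>"
    and T: "0 \<le> T" "T \<le> 1"
    and mem: "\<And>t. t \<in> {0..T} \<Longrightarrow> \<gamma> t \<in> ball p (R / 2) \<and> B * bdist \<Omega> (\<gamma> t) \<le> 1 / 2"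
    and w: "w = (\<lambda>z. Re (h z) / (1 + 2 * B * C * Re (h z)))"
    and D: "0 < D" "\<And>z. z \<in> \<Omega> \<Longrightarrow> z \<in> ball p R \<Longrightarrow> bdist \<Omega> z \<le> D * w z"
    and d0: "0 < d0" "w (\<gamma> 0) \<le> d0"
    and \<theta>: "\<theta> = ln 2 / (2 * c0)"
    and far: "\<theta> * (\<Sum>i<N. W (2 * D * d0 * 2 ^ i)) \<le> dist (\<gamma> T) (\<gamma> 0)"
  shows "ennreal (real N / 2 * ln 2) \<le> kob_arc \<Omega> \<gamma> 0 T"
proof -
  define \<rho> where "\<rho> = (\<lambda>j. \<theta> * (\<Sum>i<j. W (2 * D * d0 * 2 ^ i)))"
  have \<theta>0: "\<theta> > 0" using c0 \<theta> by simp
  have Wp: "W (2 * D * d0 * 2 ^ j) > 0" for j using D d0 by (intro W_pos) simp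
  have \<rho>Suc: "\<rho> (Suc j) = \<rho> j + \<theta> * W (2 * D * d0 * 2 ^ j)" for j by (simp add: \<rho>_def algebra_simps)
  have \<rho>mono: "\<rho> i \<le> \<rho> j" if "i \<le> j" for i j
    using \<theta>0 that Wp unfolding \<rho>_def by (intro mult_left_mono sum_mono2) (auto intro: less_imp_le)
  have \<gamma>\<Omega>: "\<gamma> t \<in> \<Omega>" if "t \<in> {0..T}" for t using that T \<gamma>(2) by (auto simp: image_subset_iff)
  have \<gamma>R: "\<gamma> t \<in> ball p R" if "t \<in> {0..T}" for t using mem[OF that] R by auto
  have u: "0 < Re (h (\<gamma> t))" "(h has_derivative h' (\<gamma> t)) (at (\<gamma> t))" if "t \<in> {0..T}" for t
    using h \<gamma>\<Omega>[OF that] \<gamma>R[OF that] by (auto simp: support_fn_def)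
  have up: "0 < 1 + 2 * B * C * Re (h (\<gamma> t))" if "t \<in> {0..T}" for t
    using u(1)[OF that] B C by (intro add_pos_pos mult_pos_pos) auto
  have wp: "0 < w (\<gamma> t)" if "t \<in> {0..T}" for t
    using u(1)[OF that] up[OF that] by (simp add: w)
  have cont\<gamma>: "continuous_on {0..T} \<gamma>"
    using \<gamma>(1) T by (auto simp: piecewise_C1_differentiable_on_def intro: continuous_on_subset)
  have contw: "continuous_on {0..T} (\<lambda>t. w (\<gamma> t))"
  proof -
    have "continuous_on (\<gamma> ` {0..T}) h"
      using u has_derivative_continuous by (intro continuous_at_imp_continuous_on) blast
    then have "continuous_on {0..T} (\<lambda>t. h (\<gamma> t))"
      by (rule continuous_on_compose2[OF _ cont\<gamma>]) simp
    then show ?thesis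
      unfolding w using up by (intro continuous_intros) (auto simp: less_imp_neq[symmetric])
  qed
  have "\<exists>s\<in>{0..T}. ennreal (real j / 2 * ln 2) \<le> kob_arc \<Omega> \<gamma> 0 s \<and> w (\<gamma> s) \<le> 2 ^ j * d0 \<and> norm (\<gamma> s - \<gamma> 0) \<le> \<rho> j"
    if "j \<le> N" for j
    using that
  proof (induction j)
    case 0
    then show ?case using d0 T by (intro bexI[of _ 0]) (auto simp: \<rho>_def)
  next
    case (Suc j)
    then obtain s where s: "s \<in> {0..T}" and L: "ennreal (real j / 2 * ln 2) \<le> kob_arc \<Omega> \<gamma> 0 s"
      and ws: "w (\<gamma> s) \<le> 2 ^ j * d0" and ns: "norm (\<gamma> s - \<gamma> 0) \<le> \<rho> j" by auto
    define V where "V = W (2 * D * d0 * 2 ^ j)"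
    have V: "V > 0" using Wp by (simp add: V_def)
    \<comment> \<open>Both events are normalised to the value 1, so the first exit of one continuous
      function finds whichever comes first.\<close>
    define \<phi> where "\<phi> = (\<lambda>t. max (w (\<gamma> t) / (2 ^ Suc j * d0)) (norm (\<gamma> t - \<gamma> s) / (\<theta> * V)))"
    have sub: "{s..T} \<subseteq> {0..T}" using s by auto
    have cont: "continuous_on {s..T} \<phi>"
      unfolding \<phi>_def using d0 \<theta>0 V
      by (intro continuous_intros continuous_on_subset[OF contw sub] continuous_on_subset[OF cont\<gamma> sub]) auto
    have lt: "\<phi> s < 1"
    proof -
      have "w (\<gamma> s) < 2 ^ Suc j * d0" using ws d0 by (simp add: le_less_trans)
      then show ?thesis using d0 by (simp add: \<phi>_def)
    qed
    \<comment> \<open>Up to s at most \<rho> j of the distance, at least \<rho> N, reached at T has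
      been used, so \<theta> * V is still to be covered and an event must occur.\<close>
    have ge: "1 \<le> \<phi> T"
    proof -
      have "\<rho> j + \<theta> * V \<le> \<rho> N" using \<rho>mono[OF Suc.prems] \<rho>Suc[of j] by (simp add: V_def)
      also have "\<dots> \<le> norm (\<gamma> T - \<gamma> 0)" using far by (simp add: \<rho>_def dist_norm)
      also have "\<dots> \<le> norm (\<gamma> T - \<gamma> s) + norm (\<gamma> s - \<gamma> 0)"
        using norm_triangle_ineq[of "\<gamma> T - \<gamma> s" "\<gamma> s - \<gamma> 0"] by simp
      finally have "\<theta> * V \<le> norm (\<gamma> T - \<gamma> s)" using ns by simp
      then have "1 \<le> norm (\<gamma> T - \<gamma> s) / (\<theta> * V)" using \<theta>0 V by simp
      then show ?thesis by (simp add: \<phi>_def)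
    qed
    have sT: "s \<le> T" using s by simp
    obtain s' where s': "s \<le> s'" "s' \<le> T" "\<phi> s' = 1" "\<And>t. s \<le> t \<Longrightarrow> t \<le> s' \<Longrightarrow> \<phi> t \<le> 1"
      using first_exit[OF cont sT lt ge] by blast
    have wle: "w (\<gamma> t) \<le> 2 ^ Suc j * d0" if "t \<in> {s..s'}" for t
      using s'(4)[of t] that d0 by (simp add: \<phi>_def)
    \<comment> \<open>Until the event \<open>w\<close> is at most twice the level 2 ^ j * d0. This
      is the origin of the factor 2 in the scales, and it bounds the weight on this piece by
      V.\<close>
    have bd: "bdist \<Omega> (\<gamma> t) \<le> 2 * D * d0 * 2 ^ j" if "t \<in> {s..s'}" for t
    proof -
      have "t \<in> {0..T}" using that s s' by auto
      then have "bdist \<Omega> (\<gamma> t) \<le> D * w (\<gamma> t)" using D(2) \<gamma>\<Omega> \<gamma>R by blast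
      also have "\<dots> \<le> D * (2 ^ Suc j * d0)" using wle[OF that] D by (intro mult_left_mono) auto
      finally show ?thesis by (simp add: mult_ac)
    qed
    \<comment> \<open>The choice of \<theta> makes a displacement \<theta> * V cost c0 * \<theta> =
      (1/2) ln 2, the same as a doubling of \<open>w\<close>.\<close>
    have step: "ennreal (1/2 * ln 2) \<le> kob_arc \<Omega> \<gamma> s s'"
    proof -
      consider "w (\<gamma> s') = 2 ^ Suc j * d0" | "norm (\<gamma> s' - \<gamma> s) = \<theta> * V"
        using s'(3) d0 \<theta>0 V by (auto simp: \<phi>_def max_def field_simps split: if_splits)
      then show ?thesis
      proof cases
        case 1
        have "2 * w (\<gamma> s) \<le> w (\<gamma> s')" using 1 ws by simp
        then have "ln (2 * w (\<gamma> s)) \<le> ln (w (\<gamma> s'))" using wp[OF s] by (intro ln_mono) auto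
        then have "ln 2 + ln (w (\<gamma> s)) \<le> ln (w (\<gamma> s'))" using wp[OF s] by (simp add: ln_mult)
        then have "1/2 * ln 2 \<le> \<bar>1/2 * ln (w (\<gamma> s')) - 1/2 * ln (w (\<gamma> s))\<bar>" by linarith
        also have "ennreal \<dots> \<le> kob_arc \<Omega> \<gamma> s s'"
        proof (rule kob_arc_ge_log[where a = s and b = s' and \<gamma> = \<gamma> and w = w, OF h C B R near \<gamma> _ _ _ _ w])
          show "\<gamma> t \<in> ball p (R / 2) \<and> B * bdist \<Omega> (\<gamma> t) \<le> 1 / 2" if "t \<in> {s..s'}" for t
            using that s s' by (intro mem) auto
        qed (use s s' T in auto)
        finally show ?thesis by (simp add: ennreal_leI)
      next
        case 2
        have "c0 * norm (\<gamma> s' - \<gamma> s) / V = 1/2 * ln 2" using 2 V c0 by (simp add: \<theta>)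
        moreover have "ennreal (c0 * norm (\<gamma> s' - \<gamma> s) / V) \<le> kob_arc \<Omega> \<gamma> s s'"
          unfolding V_def using s s' T by (intro kob_arc_ge_norm[OF \<gamma>] bd) auto
        ultimately show ?thesis by metis
      qed
    qed
    have "ennreal (real (Suc j) / 2 * ln 2) = ennreal (real j / 2 * ln 2) + ennreal (1/2 * ln 2)"
      by (subst ennreal_plus[symmetric]) (auto simp: field_simps)
    also have "\<dots> \<le> kob_arc \<Omega> \<gamma> 0 s + kob_arc \<Omega> \<gamma> s s'" using L step by (rule add_mono)
    also have "\<dots> \<le> kob_arc \<Omega> \<gamma> 0 s'" using s s' by (intro kob_arc_add) auto
    finally have "ennreal (real (Suc j) / 2 * ln 2) \<le> kob_arc \<Omega> \<gamma> 0 s'" .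
    moreover have "norm (\<gamma> s' - \<gamma> 0) \<le> \<rho> (Suc j)"
    proof -
      have "norm (\<gamma> s' - \<gamma> s) / (\<theta> * V) \<le> 1" using s'(3) by (simp add: \<phi>_def)
      then have "norm (\<gamma> s' - \<gamma> s) \<le> \<theta> * V" using \<theta>0 V by (simp add: pos_divide_le_eq)
      then show ?thesis
        using ns norm_triangle_ineq[of "\<gamma> s' - \<gamma> s" "\<gamma> s - \<gamma> 0"] \<rho>Suc[of j] by (simp add: V_def)
    qed
    ultimately show ?case using wle[of s'] s s' by (intro bexI[of _ s']) auto
  qed
  from this[of N] obtain s where s: "s \<in> {0..T}" "ennreal (real N / 2 * ln 2) \<le> kob_arc \<Omega> \<gamma> 0 s" by auto
  have "kob_arc \<Omega> \<gamma> 0 s \<le> kob_arc \<Omega> \<gamma> 0 s + kob_arc \<Omega> \<gamma> s T" by simp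
  also have "\<dots> \<le> kob_arc \<Omega> \<gamma> 0 T" using s by (intro kob_arc_add) auto
  finally show ?thesis using s(2) by (rule order_trans[rotated])
qed

section \<open>Lower bounds for the length of a path\<close>

text \<open>The end point is arbitrary. A path that stays close to x is settled by comparing
  \<open>w\<close> with the boundary distance at both ends. Otherwise the piece up to the exit
  already has length (1/2) ln (1 / \<open>bdist \<Omega> x\<close>) up to a constant, enough for any
  end point because boundary distances in \<Omega> are at most M.\<close>

lemma length_lower_bound_near_boundary:
  assumes cvx: "convexifiable \<Omega>" and p: "p \<in> frontier \<Omega>"
  obtains r c where "0 < r"
    "\<And>x \<gamma>. x \<in> \<Omega> \<Longrightarrow> x \<in> ball p r \<Longrightarrow> \<gamma> piecewise_C1_differentiable_on {0..1} \<Longrightarrow> \<gamma> ` {0..1} \<subseteq> \<Omega> \<Longrightarrow> \<gamma> 0 = x \<Longrightarrow>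
      ennreal (1/2 * ln (bdist \<Omega> (\<gamma> 1) / bdist \<Omega> x) - c) \<le> kob_length \<Omega> \<gamma>"
proof -
  obtain R C where R: "R > 0" and C: "C > 0"
    and supp: "\<And>x. x \<in> \<Omega> \<Longrightarrow> x \<in> ball p R \<Longrightarrow> \<exists>h h'. support_fn \<Omega> p R C h h' \<and> Re (h x) \<le> C * bdist \<Omega> x"
    using local_support[OF op cvx p] by metis
  obtain B where B: "0 < B" and near: "discs_confined \<Omega> p R B"
    using discs_stay_near[OF R C supp] by metis
  obtain M where M: "M > 0" "\<And>x. x \<in> \<Omega> \<Longrightarrow> bdist \<Omega> x \<le> M" using bounded_bdist[OF bd] by (metis (no_types, lifting))
  \<comment> \<open>Within R1 of p both hypotheses of the logarithmic estimate hold, the second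
    because \<open>bdist\<close> is at most the distance to p. Halving R1 keeps points within \<rho>
    of x in that ball.\<close>
  define R1 where "R1 = min (R / 2) (1 / (2 * B))"
  have R1: "R1 > 0" "R1 \<le> R / 2" "B * R1 \<le> 1 / 2" using R B by (auto simp: R1_def min_def field_simps)
  define \<rho> where "\<rho> = R1 / 2"
  have \<rho>: "\<rho> > 0" using R1 by (simp add: \<rho>_def)
  \<comment> \<open>With u = \<open>Re (h z)\<close>, this combines the bound of
    \<open>bdist\<close> by C * u, the identity u = (1 + 2 * B * C * u) * \<open>w z\<close> and u
    \<le> C.\<close>
  define D where "D = C * (1 + 2 * B * C * C)"
  have D: "D > 0" using B C by (simp add: D_def add_pos_pos)
  define \<theta> where "\<theta> = ln 2 / (2 * c0)"
  have \<theta>: "\<theta> > 0" using c0 by (simp add: \<theta>_def)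
  have "0 < \<rho> / \<theta>" using \<rho> \<theta> by simp
  from W_dyadic[OF this] obtain \<epsilon> where \<epsilon>: "\<epsilon> > 0"
    "\<And>a. a > 0 \<Longrightarrow> \<exists>K::nat. (\<Sum>i<K. W (a * 2 ^ i)) \<le> \<rho> / \<theta> \<and> \<epsilon> < a * 2 ^ K" by blast
  \<comment> \<open>The first term covers paths that stay close, with D from the end point and C
    from the start; the second covers paths that exit.\<close>
  define c where "c = \<bar>ln (D * C)\<bar> + \<bar>ln (2 * D * C * M / \<epsilon>)\<bar>"
  show thesis
  proof (rule that[OF \<rho>, of c])
    fix x \<gamma> assume x: "x \<in> \<Omega>" "x \<in> ball p \<rho>"
      and \<gamma>: "\<gamma> piecewise_C1_differentiable_on {0..1}" "\<gamma> ` {0..1} \<subseteq> \<Omega>" "\<gamma> 0 = x"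
    define y where "y = \<gamma> 1"
    have y: "y \<in> \<Omega>" unfolding y_def by (rule subsetD[OF \<gamma>(2) imageI]) simp
    have xR: "x \<in> ball p R" using x R1 R by (auto simp: \<rho>_def)
    obtain h h' where h: "support_fn \<Omega> p R C h h'" and hx: "Re (h x) \<le> C * bdist \<Omega> x"
      using supp[OF x(1) xR] by blast
    define w where "w = (\<lambda>z. Re (h z) / (1 + 2 * B * C * Re (h z)))"
    have \<delta>x: "0 < bdist \<Omega> x" and \<delta>y: "0 < bdist \<Omega> y" using bdist_pos[OF op bd] x y by auto
    have hz: "0 < Re (h z)" "bdist \<Omega> z \<le> C * Re (h z)" "Re (h z) \<le> C" "0 < w z" "w z \<le> Re (h z)" "bdist \<Omega> z \<le> D * w z"
      if "z \<in> \<Omega>" "z \<in> ball p R" for z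
    proof -
      show a: "0 < Re (h z)" "bdist \<Omega> z \<le> C * Re (h z)" "Re (h z) \<le> C"
        using h that by (auto simp: support_fn_def)
      have g1: "1 \<le> 1 + 2 * B * C * Re (h z)" using a B C by simp
      show "0 < w z" using a g1 by (simp add: w_def)
      show "w z \<le> Re (h z)" using a g1 by (simp add: w_def divide_le_eq mult_le_cancel_left1)
      have "Re (h z) = (1 + 2 * B * C * Re (h z)) * w z" using g1 by (simp add: w_def)
      also have "\<dots> \<le> (1 + 2 * B * C * C) * w z"
        using a B C \<open>0 < w z\<close> by (intro mult_right_mono add_left_mono mult_left_mono) auto
      finally have "C * Re (h z) \<le> D * w z" using C by (simp add: D_def mult.assoc mult_left_mono)
      then show "bdist \<Omega> z \<le> D * w z" using a by simp
    qed
    have ball: "z \<in> ball p (R / 2) \<and> B * bdist \<Omega> z \<le> 1 / 2" if "dist x z \<le> \<rho>" for z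
    proof -
      have "dist p z < R1" using that x dist_triangle[of p z x] by (simp add: \<rho>_def)
      moreover have "bdist \<Omega> z \<le> dist z p" unfolding bdist_def by (rule infdist_le[OF p])
      ultimately have "bdist \<Omega> z \<le> R1" by (simp add: dist_commute)
      then have "B * bdist \<Omega> z \<le> B * R1" using B by (intro mult_left_mono) auto
      then have "B * bdist \<Omega> z \<le> 1 / 2" using R1(3) by (rule order_trans)
      then show ?thesis using \<open>dist p z < R1\<close> R1 by simp
    qed
    show "ennreal (1/2 * ln (bdist \<Omega> (\<gamma> 1) / bdist \<Omega> x) - c) \<le> kob_length \<Omega> \<gamma>"
    proof (cases "\<exists>t\<in>{0..1}. \<rho> \<le> dist x (\<gamma> t)")
      case False
      then have in\<rho>: "dist x (\<gamma> t) \<le> \<rho>" if "t \<in> {0..1}" for t using that by force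
      have yR: "y \<in> ball p R" using ball[OF in\<rho>[of 1]] R by (auto simp: y_def)
      have "bdist \<Omega> y \<le> D * w y" using hz y yR by blast
      then have 1: "ln (bdist \<Omega> y) \<le> ln D + ln (w y)"
        using hz(4)[OF y yR] \<delta>y D ln_mono[of "bdist \<Omega> y" "D * w y"] by (simp add: ln_mult)
      have "w x \<le> C * bdist \<Omega> x" using hz(5)[OF x(1) xR] hx by simp
      then have 2: "ln (w x) \<le> ln C + ln (bdist \<Omega> x)"
        using hz(4)[OF x(1) xR] \<delta>x C ln_mono[of "w x" "C * bdist \<Omega> x"] by (simp add: ln_mult)
      have "ln (bdist \<Omega> y / bdist \<Omega> x) \<le> ln (w y) - ln (w x) + \<bar>ln (D * C)\<bar>"
      proof -
        have "ln (D * C) = ln D + ln C" "ln (bdist \<Omega> y / bdist \<Omega> x) = ln (bdist \<Omega> y) - ln (bdist \<Omega> x)"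
          using \<delta>x \<delta>y C D by (simp_all add: ln_div ln_mult)
        then show ?thesis using 1 2 by linarith
      qed
      then have "1/2 * ln (bdist \<Omega> y / bdist \<Omega> x) - c \<le> \<bar>1/2 * ln (w (\<gamma> 1)) - 1/2 * ln (w (\<gamma> 0))\<bar>"
        using \<gamma> by (simp add: c_def y_def)
      also have "ennreal \<dots> \<le> kob_arc \<Omega> \<gamma> 0 1"
        by (rule kob_arc_ge_log[where a = 0 and b = 1 and \<gamma> = \<gamma> and w = w, OF h C B R near \<gamma>(1,2) _ _ _ _ w_def]) (use ball in\<rho> in auto)
      also have "\<dots> \<le> kob_length \<Omega> \<gamma>" by (rule kob_arc_le_length) auto
      finally show ?thesis by (simp add: y_def ennreal_leI)
    next
      case True
      then obtain t where t: "t \<in> {0..1}" "\<rho> \<le> dist x (\<gamma> t)" by blast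
      have cont: "continuous_on {0..t} (\<lambda>s. dist x (\<gamma> s))"
        using \<gamma>(1) t by (intro continuous_intros) (auto simp: piecewise_C1_differentiable_on_def intro: continuous_on_subset)
      obtain T where T: "0 \<le> T" "T \<le> t" "dist x (\<gamma> T) = \<rho>" "\<And>s. 0 \<le> s \<Longrightarrow> s \<le> T \<Longrightarrow> dist x (\<gamma> s) \<le> \<rho>"
        using first_exit[OF cont _ _ t(2)] t \<rho> \<gamma>(3) by auto
      have T1: "T \<le> 1" using T t by simp
      have d0: "0 < w x" using hz x xR by blast
      have a: "0 < 2 * D * w x" using D d0 by simp
      \<comment> \<open>The displacement \<rho> pays for N scales, and since \<open>w x\<close> is
        at most C * \<open>bdist \<Omega> x\<close>, reaching \<epsilon> forces 2 ^ N to exceed a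
        constant over \<open>bdist \<Omega> x\<close>.\<close>
      obtain N :: nat where N: "(\<Sum>i<N. W (2 * D * w x * 2 ^ i)) \<le> \<rho> / \<theta>" "\<epsilon> < 2 * D * w x * 2 ^ N"
        using \<epsilon>(2)[OF a] by blast
      have "ennreal (real N / 2 * ln 2) \<le> kob_arc \<Omega> \<gamma> 0 T"
      proof (rule kob_arc_crossing[where \<gamma> = \<gamma> and w = w and T = T and N = N and \<theta> = \<theta> and D = D, OF h C B R near \<gamma>(1,2) T(1) T1 _ w_def D _ d0 _ \<theta>_def])
        show "\<theta> * (\<Sum>i<N. W (2 * D * w x * 2 ^ i)) \<le> dist (\<gamma> T) (\<gamma> 0)"
          using N(1) \<theta> T(3) \<gamma>(3) by (simp add: dist_commute field_simps)
      qed (use ball T hz \<gamma> in auto)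
      also have "\<dots> \<le> kob_length \<Omega> \<gamma>" using T1 by (intro kob_arc_le_length) auto
      finally have L: "ennreal (real N / 2 * ln 2) \<le> kob_length \<Omega> \<gamma>" .
      have "w x \<le> C * bdist \<Omega> x" using hz(5)[OF x(1) xR] hx by simp
      then have "2 * D * w x * 2 ^ N \<le> 2 * D * (C * bdist \<Omega> x) * 2 ^ N"
        using D by (intro mult_right_mono mult_left_mono) auto
      then have "\<epsilon> \<le> 2 * D * C * bdist \<Omega> x * 2 ^ N" using N by (simp add: mult.assoc)
      then have "\<epsilon> * bdist \<Omega> y \<le> (2 * D * C * bdist \<Omega> x * 2 ^ N) * M"
        using M(2)[OF y] \<delta>y \<delta>x D C by (intro mult_mono) auto
      then have "bdist \<Omega> y / bdist \<Omega> x \<le> (2 * D * C * M / \<epsilon>) * 2 ^ N"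
        using \<epsilon>(1) \<delta>x by (simp add: field_simps)
      then have "ln (bdist \<Omega> y / bdist \<Omega> x) - ln (2 ^ N) \<le> \<bar>ln (2 * D * C * M / \<epsilon>)\<bar>"
        using \<delta>x \<delta>y D C M \<epsilon> by (intro ln_le_of_quotient) auto
      then have "1/2 * ln (bdist \<Omega> y / bdist \<Omega> x) - c \<le> real N / 2 * ln 2"
        by (simp add: c_def ln_realpow)
      then show ?thesis using L by (metis ennreal_leI order_trans y_def)
    qed
  qed
qed

text \<open>Only the starting point is localised, so finitely many balls covering the closure
  suffice. Near an interior point the logarithm is bounded above, and a large constant makes the
  left side negative, which \<open>ennreal\<close> turns into 0.\<close>

lemma length_lower_bound:
  assumes cvx: "convexifiable \<Omega>"
  obtains c where "0 < c"
    "\<And>x \<gamma>. x \<in> \<Omega> \<Longrightarrow> \<gamma> piecewise_C1_differentiable_on {0..1} \<Longrightarrow> \<gamma> ` {0..1} \<subseteq> \<Omega> \<Longrightarrow> \<gamma> 0 = x \<Longrightarrow>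
      ennreal (1/2 * ln (bdist \<Omega> (\<gamma> 1) / bdist \<Omega> x) - c) \<le> kob_length \<Omega> \<gamma>"
proof -
  let ?P = "\<lambda>p r c. 0 < r \<and> (\<forall>x \<gamma>. x \<in> \<Omega> \<longrightarrow> x \<in> ball p r \<longrightarrow> \<gamma> piecewise_C1_differentiable_on {0..1} \<longrightarrow>
      \<gamma> ` {0..1} \<subseteq> \<Omega> \<longrightarrow> \<gamma> 0 = x \<longrightarrow> ennreal (1/2 * ln (bdist \<Omega> (\<gamma> 1) / bdist \<Omega> x) - c) \<le> kob_length \<Omega> \<gamma>)"
  obtain M where M: "M > 0" "\<And>x. x \<in> \<Omega> \<Longrightarrow> bdist \<Omega> x \<le> M" using bounded_bdist[OF bd] by (metis (no_types, lifting))
  have "\<exists>r c. ?P p r c" if "p \<in> closure \<Omega>" for p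
  proof (cases "p \<in> \<Omega>")
    case False
    then have p: "p \<in> frontier \<Omega>" using that op by (simp add: frontier_def interior_open)
    show ?thesis
      by (rule length_lower_bound_near_boundary[OF cvx p], rule exI, rule exI) blast
  next
    case True
    define \<delta> where "\<delta> = bdist \<Omega> p"
    have \<delta>: "\<delta> > 0" unfolding \<delta>_def by (rule bdist_pos[OF op bd True])
    have "?P p (\<delta> / 2) \<bar>ln (2 * M / \<delta>)\<bar>"
    proof (intro conjI allI impI)
      fix x and \<gamma> :: "real \<Rightarrow> complex ^ 'n" assume x: "x \<in> \<Omega>" "x \<in> ball p (\<delta> / 2)" and \<gamma>: "\<gamma> ` {0..1} \<subseteq> \<Omega>"
      have y: "\<gamma> 1 \<in> \<Omega>" by (rule subsetD[OF \<gamma> imageI]) simp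
      have dx: "\<delta> / 2 \<le> bdist \<Omega> x" using bdist_lipschitz[of \<Omega> p x] x by (simp add: \<delta>_def)
      have dy: "0 < bdist \<Omega> (\<gamma> 1)" by (rule bdist_pos[OF op bd y])
      have "bdist \<Omega> (\<gamma> 1) * \<delta> \<le> M * (2 * bdist \<Omega> x)"
        using M(2)[OF y] dx \<delta> M dy by (intro mult_mono) auto
      then have "bdist \<Omega> (\<gamma> 1) \<le> (2 * M / \<delta>) * bdist \<Omega> x" using \<delta> by (simp add: field_simps)
      then have "ln (bdist \<Omega> (\<gamma> 1)) - ln (bdist \<Omega> x) \<le> \<bar>ln (2 * M / \<delta>)\<bar>"
        using dx dy \<delta> M by (intro ln_le_of_quotient) auto
      then have "1/2 * ln (bdist \<Omega> (\<gamma> 1) / bdist \<Omega> x) - \<bar>ln (2 * M / \<delta>)\<bar> \<le> 0"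
        using dx dy \<delta> by (simp add: ln_div)
      then show "ennreal (1/2 * ln (bdist \<Omega> (\<gamma> 1) / bdist \<Omega> x) - \<bar>ln (2 * M / \<delta>)\<bar>) \<le> kob_length \<Omega> \<gamma>"
        by (simp add: ennreal_neg)
    qed (use \<delta> in simp)
    then show ?thesis by blast
  qed
  then obtain r c where rc: "\<And>p. p \<in> closure \<Omega> \<Longrightarrow> ?P p (r p) (c p)" by metis
  have "compact (closure \<Omega>)" using bd by simp
  then obtain F where F: "F \<subseteq> closure \<Omega>" "finite F" "closure \<Omega> \<subseteq> (\<Union>p\<in>F. ball p (r p))"
  proof (rule compactE_image[of _ "closure \<Omega>" "\<lambda>p. ball p (r p)"])
    show "closure \<Omega> \<subseteq> (\<Union>p\<in>closure \<Omega>. ball p (r p))" using rc by force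
  qed auto
  \<comment> \<open>The sum of absolute values dominates each constant and makes sense even for
    empty \<open>F\<close>; adding 1 gives positivity.\<close>
  define c' where "c' = (\<Sum>p\<in>F. \<bar>c p\<bar>) + 1"
  have c'0: "0 < c'" by (simp add: c'_def add_nonneg_pos sum_nonneg)
  show thesis
  proof (rule that[OF c'0])
    fix x \<gamma> assume x: "x \<in> \<Omega>" and \<gamma>: "\<gamma> piecewise_C1_differentiable_on {0..1}" "\<gamma> ` {0..1} \<subseteq> \<Omega>" "\<gamma> 0 = x"
    obtain p where p: "p \<in> F" "x \<in> ball p (r p)" using F x closure_subset by blast
    have "\<bar>c p\<bar> \<le> (\<Sum>p\<in>F. \<bar>c p\<bar>)" by (rule member_le_sum) (use p F in auto)
    then have "c p \<le> c'" by (simp add: c'_def)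
    then have "ennreal (1/2 * ln (bdist \<Omega> (\<gamma> 1) / bdist \<Omega> x) - c') \<le> ennreal (1/2 * ln (bdist \<Omega> (\<gamma> 1) / bdist \<Omega> x) - c p)"
      by (intro ennreal_leI) simp
    also have "\<dots> \<le> kob_length \<Omega> \<gamma>" using rc[of p] p F x \<gamma> by blast
    finally show "ennreal (1/2 * ln (bdist \<Omega> (\<gamma> 1) / bdist \<Omega> x) - c') \<le> kob_length \<Omega> \<gamma>" .
  qed
qed

end

section \<open>From lengths to the distance\<close>

text \<open>\<open>kob_dist\<close> passes through \<open>enn2real\<close>, which sends infinity to
  0, so a bound on all lengths transfers only if some length is finite. A polynomial path has
  bounded speed and keeps a positive distance m from the boundary, so affine discs bound the metric
  along it.\<close>

lemma exists_finite_length_path: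
  fixes \<Omega> :: "(complex ^ 'n) set"
  assumes op: "open \<Omega>" and "connected \<Omega>" and bd: "bounded \<Omega>" and xy: "x \<in> \<Omega>" "y \<in> \<Omega>"
  obtains \<gamma> where "\<gamma> piecewise_C1_differentiable_on {0..1}" "\<gamma> ` {0..1} \<subseteq> \<Omega>" "\<gamma> 0 = x" "\<gamma> 1 = y"
    "kob_length \<Omega> \<gamma> < \<infinity>"
proof -
  obtain g where "polynomial_function g" "path_image g \<subseteq> \<Omega>" "pathstart g = x" "pathfinish g = y"
    using connected_open_polynomial_connected[OF assms(1,2) xy] by metis
  then have g: "polynomial_function g" "g ` {0..1} \<subseteq> \<Omega>" "g 0 = x" "g 1 = y"
    by (simp_all add: path_image_def pathstart_def pathfinish_def)
  obtain g' where g': "polynomial_function g'" "\<And>t. (g has_vector_derivative g' t) (at t)"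
    using has_vector_derivative_polynomial_function[OF g(1)] by blast
  have contg: "continuous_on {0..1} g" and contg': "continuous_on S g'" for S
    using g(1) g'(1) by (auto intro: continuous_on_polymonial_function)
  have C1: "g piecewise_C1_differentiable_on {0..1}"
    using contg contg' g'(2) unfolding piecewise_C1_differentiable_on_def C1_differentiable_on_def
    by (intro conjI exI[of _ "{}"]) auto
  have "compact ((\<lambda>t. norm (g' t)) ` {0..1})" "compact ((\<lambda>t. bdist \<Omega> (g t)) ` {0..1})"
    by (auto intro!: compact_continuous_image continuous_intros contg' continuous_on_compose2[OF continuous_on_bdist contg])
  then obtain M where M: "\<And>t. t \<in> {0..1} \<Longrightarrow> norm (g' t) \<le> M"
    and "\<exists>t\<in>{0..1}. \<forall>s\<in>{0..1}. bdist \<Omega> (g t) \<le> bdist \<Omega> (g s)"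
    using compact_attains_inf[of "(\<lambda>t. bdist \<Omega> (g t)) ` {0..1}"] compact_attains_sup[of "(\<lambda>t. norm (g' t)) ` {0..1}"] by force
  then obtain t0 where t0: "t0 \<in> {0..1}" "\<And>s. s \<in> {0..1} \<Longrightarrow> bdist \<Omega> (g t0) \<le> bdist \<Omega> (g s)" by blast
  define m where "m = bdist \<Omega> (g t0)"
  have m: "m > 0" unfolding m_def using t0 g(2) by (intro bdist_pos[OF op bd]) (auto simp: image_subset_iff)
  have "kob_royden \<Omega> (g t) (vector_derivative g (at t)) \<le> M / m" if t: "t \<in> {0..1}" for t
  proof -
    have "g t \<in> \<Omega>" using t g(2) by (auto simp: image_subset_iff)
    from ball_bdist_subset[OF this] have "ball (g t) m \<subseteq> \<Omega>"
      using t0(2)[OF t] by (auto simp: m_def subset_eq)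
    then have "kob_royden \<Omega> (g t) (vector_derivative g (at t)) \<le> norm (vector_derivative g (at t)) / m"
      by (rule kob_royden_le_norm[OF m])
    also have "\<dots> \<le> M / m" using M[OF t] m vector_derivative_at[OF g'(2)[of t]] by (simp add: divide_right_mono)
    finally show ?thesis .
  qed
  note bound = this
  have "kob_length \<Omega> g \<le> (\<integral>\<^sup>+ t. ennreal (M / m) * indicator {0..1::real} t \<partial>lborel)"
    unfolding kob_length_def by (rule nn_integral_mono) (use bound in \<open>auto simp: indicator_def intro: ennreal_leI\<close>)
  also have "\<dots> = ennreal (M / m) * emeasure lborel {0..1::real}" by (subst nn_integral_cmult_indicator) auto
  also have "\<dots> < \<infinity>" by (simp add: ennreal_mult_less_top)
  finally show thesis using that[OF C1 g(2-4)] by blast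
qed

text \<open>For negative a the left premise degenerates to 0 \<le> b, but then the claim holds
  because \<open>enn2real\<close> is nonnegative.\<close>

lemma le_enn2real: "ennreal a \<le> b \<Longrightarrow> b < \<infinity> \<Longrightarrow> a \<le> enn2real b"
  by (cases b rule: ennreal_cases) (auto simp: ennreal_le_iff2)

theorem theorem4p9:
  fixes \<Omega> :: "(complex ^ 'n) set"
  assumes "open \<Omega>" and "connected \<Omega>"
    and "convexifiable \<Omega>" and "strongly_goldilocks \<Omega>"
  shows "\<exists>c>0. \<forall>x\<in>\<Omega>. \<forall>y\<in>\<Omega>.
           kob_dist \<Omega> x y \<ge> 1/2 * ln (bdist \<Omega> y / bdist \<Omega> x) - c"
proof -
  obtain c0 and w :: "real \<Rightarrow> real" where bd: "bounded \<Omega>" and c0: "c0 > 0" and pos: "\<forall>t>0. w t > 0"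
    and kob: "\<forall>x\<in>\<Omega>. \<forall>v. kob_royden \<Omega> x v \<ge> c0 * norm v / w (bdist \<Omega> x)"
    and dec: "\<forall>s t. 0 < s \<longrightarrow> s \<le> t \<longrightarrow> w t / t \<le> w s / s"
    and inc: "\<forall>s t. 0 < s \<longrightarrow> s \<le> t \<longrightarrow> w s * ln (w s / s) \<le> w t * ln (w t / t)"
    and int: "\<forall>\<epsilon>>0. (\<lambda>t. (w t / t) * ln (w t / t)) integrable_on {0<..\<epsilon>}"
    using assms(4) unfolding strongly_goldilocks_def by (elim conjE exE) (rule that)
  note pos = pos[rule_format] and kob = kob[rule_format] and dec = dec[rule_format]
    and inc = inc[rule_format] and int = int[rule_format, OF zero_less_one]
  obtain W where W: "\<And>t. 0 < t \<Longrightarrow> w t \<le> W t" "\<And>t. 0 < t \<Longrightarrow> 0 < W t"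
    "\<And>s t. 0 < s \<Longrightarrow> s \<le> t \<Longrightarrow> W s \<le> W t"
    "\<And>\<eta>. 0 < \<eta> \<Longrightarrow> \<exists>\<epsilon>>0. \<forall>a>0. \<exists>K::nat. (\<Sum>i<K. W (a * 2 ^ i)) \<le> \<eta> \<and> \<epsilon> < a * 2 ^ K"
    by (rule dini_majorant[of w, OF pos dec inc int]) blast+
  interpret log_weighted_domain \<Omega> c0 W
  proof
    fix x v :: "complex ^ 'n" assume x: "x \<in> \<Omega>"
    have "0 < bdist \<Omega> x" by (rule bdist_pos[OF assms(1) bd x])
    then have "c0 * norm v / W (bdist \<Omega> x) \<le> c0 * norm v / w (bdist \<Omega> x)"
      using W pos c0 by (intro divide_left_mono) auto
    then show "c0 * norm v / W (bdist \<Omega> x) \<le> kob_royden \<Omega> x v" using kob[OF x] order_trans by blast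
  qed (use assms(1) bd c0 W in auto)
  obtain c where c: "0 < c"
    "\<And>x \<gamma>. x \<in> \<Omega> \<Longrightarrow> \<gamma> piecewise_C1_differentiable_on {0..1} \<Longrightarrow> \<gamma> ` {0..1} \<subseteq> \<Omega> \<Longrightarrow> \<gamma> 0 = x \<Longrightarrow>
      ennreal (1/2 * ln (bdist \<Omega> (\<gamma> 1) / bdist \<Omega> x) - c) \<le> kob_length \<Omega> \<gamma>"
    using length_lower_bound[OF assms(3)] by metis
  have "1/2 * ln (bdist \<Omega> y / bdist \<Omega> x) - c \<le> kob_dist \<Omega> x y" if xy: "x \<in> \<Omega>" "y \<in> \<Omega>" for x y
    unfolding kob_dist_def
  proof (rule le_enn2real)
    let ?P = "{\<gamma>. \<gamma> piecewise_C1_differentiable_on {0..1} \<and> \<gamma> ` {0..1} \<subseteq> \<Omega> \<and> \<gamma> 0 = x \<and> \<gamma> 1 = y}"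
    show "ennreal (1/2 * ln (bdist \<Omega> y / bdist \<Omega> x) - c) \<le> (INF \<gamma>\<in>?P. kob_length \<Omega> \<gamma>)"
    proof (rule INF_greatest)
      fix \<gamma> assume "\<gamma> \<in> ?P"
      then show "ennreal (1/2 * ln (bdist \<Omega> y / bdist \<Omega> x) - c) \<le> kob_length \<Omega> \<gamma>"
        using c(2)[OF xy(1), of \<gamma>] by auto
    qed
    obtain \<gamma> where \<gamma>: "\<gamma> piecewise_C1_differentiable_on {0..1}" "\<gamma> ` {0..1} \<subseteq> \<Omega>" "\<gamma> 0 = x" "\<gamma> 1 = y"
      and fin: "kob_length \<Omega> \<gamma> < \<infinity>"
      by (rule exists_finite_length_path[OF assms(1,2) bd xy])
    have "(INF \<gamma>\<in>?P. kob_length \<Omega> \<gamma>) \<le> kob_length \<Omega> \<gamma>"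
      by (rule INF_lower) (use \<gamma> in simp)
    then show "(INF \<gamma>\<in>?P. kob_length \<Omega> \<gamma>) < \<infinity>" using fin by (rule le_less_trans)
  qed
  then show ?thesis using c(1) by blast
qed

end
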